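(* Let $N$ be a smooth Riemannian manifold and let $C$ be a closed subset of $N$. There exists a weak set flow $Y$ in $N\times[0,\infty)$ (called the biggest flow generated by $C$) such that (1) $Y(0)=C$, and (2) if $Z$ is a weak set flow in $N\times[0,\infty)$ with $Z(0)\subset C$, then $Z(t)\subset Y(t)$ for all $t\ge 0$.
   Context: Smooth barriers. Let $a<b$. A family $t\in[a,b]\mapsto K(t)$ of closed subsets of $N$ is a smooth barrier if it is a smooth one-parameter family of closed regions with smooth boundary; that is, there is a smooth $f:N\times[a,b]\to\mathbf{R}$ with $K(t)=\{x: f(x,t)\le 0\}$ and spatial gradient $\nabla f(x,t)\ne 0$ whenever $f(x,t)=0$. It is compact if $\bigcup_{t\in[a,b]}K(t)$ is a compact subset of $N$. For $x\in\partial K(t)$: $\nu_K=\nabla f/|\nabla f|$ is the unit normal to $\partial K(t)$ pointing out of $K(t)$; $\mathrm{H}_K=-\mathrm{Div}(\nabla f/|\nabla f|)$ is the dot product of $\nu_K$ with the mean curvature vector of $\partial K(t)$; $\mathbf{v}_K=-\frac{1}{|\nabla f|}\frac{\partial f}{\partial t}$ is the normal velocity of $\tau\mapsto\partial K(\tau)$ in the direction $\nu_K$; and $\Phi_K=\mathbf{v}_K-\mathrm{H}_K$. Weak set flows. Let $Z$ be a closed subset of $N\times[0,\infty)$ and $Z(t)=\{x\in N:(x,t)\in Z\}$. $Z$ is a weak set flow (with starting time $0$) if: whenever $t\in[a,b]\mapsto K(t)$ is a smooth compact barrier with $a\ge 0$ such that $K(t)\cap Z(t)=\emptyset$ for all $t\in[a,b)$,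 and $p\in K(b)\cap Z(b)$, then $p\in\partial K(b)$ and $\Phi_K(p,b)\ge 0$. *)

theory Defs
  imports "HOL-Analysis.Analysis"
begin

section \<open>Smooth maps\<close>

text \<open>\<^term>\<open>S\<close> is meant to be open here.\<close>

primrec Ck_on :: "nat \<Rightarrow> 'a::real_normed_vector set \<Rightarrow> ('a \<Rightarrow> 'b::real_normed_vector) \<Rightarrow> bool" where
  "Ck_on 0 S f \<longleftrightarrow> continuous_on S f"
| "Ck_on (Suc k) S f \<longleftrightarrow>
     (\<forall>x\<in>S. f differentiable (at x)) \<and> (\<forall>v. Ck_on k S (\<lambda>x. frechet_derivative f (at x) v))"

definition smooth_on_open :: "'a::real_normed_vector set \<Rightarrow> ('a \<Rightarrow> 'b::real_normed_vector) \<Rightarrow> bool" where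
  "smooth_on_open S f \<longleftrightarrow> open S \<and> (\<forall>k. Ck_on k S f)"

text \<open>Smoothness on an arbitrary set, such as \<open>V \<times> [a,b]\<close> with \<open>V\<close> open: locally the function
  is the restriction of a smooth function on an open set.\<close>

definition smooth_on_set :: "'a::real_normed_vector set \<Rightarrow> ('a \<Rightarrow> 'b::real_normed_vector) \<Rightarrow> bool" where
  "smooth_on_set S f \<longleftrightarrow>
     (\<forall>z\<in>S. \<exists>W h. z \<in> W \<and> smooth_on_open W h \<and> (\<forall>w\<in>W \<inter> S. h w = f w))"

section \<open>Riemannian manifolds\<close>

text \<open>A manifold is a whole type carrying a smooth atlas. A chart is a pair of its domain and its
  coordinate map; values of the coordinate map outside the domain are irrelevant.\<close>

type_synonym ('a, 'n) chart = "'a set \<times> ('a \<Rightarrow> real ^ 'n)"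

abbreviation chart_dom :: "('a, 'n) chart \<Rightarrow> 'a set" where
  "chart_dom \<equiv> fst"

abbreviation chart_map :: "('a, 'n) chart \<Rightarrow> 'a \<Rightarrow> real ^ 'n" where
  "chart_map \<equiv> snd"

definition chart_inv :: "('a, 'n) chart \<Rightarrow> real ^ 'n \<Rightarrow> 'a" where
  "chart_inv c = inv_into (chart_dom c) (chart_map c)"

definition chart_image :: "('a, 'n) chart \<Rightarrow> (real ^ 'n) set" where
  "chart_image c = chart_map c ` chart_dom c"

definition transition :: "('a, 'n) chart \<Rightarrow> ('a, 'n) chart \<Rightarrow> real ^ 'n \<Rightarrow> real ^ 'n" where
  "transition c d = chart_map d \<circ> chart_inv c"

locale smooth_manifold =
  fixes A :: "('a::{t2_space, second_countable_topology}, 'n::finite) chart set"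
  assumes atlas_cover: "(\<Union>c\<in>A. chart_dom c) = UNIV"
    and open_chart_dom: "c \<in> A \<Longrightarrow> open (chart_dom c)"
    and open_chart_image: "c \<in> A \<Longrightarrow> open (chart_image c)"
    and chart_homeomorphism:
      "c \<in> A \<Longrightarrow> homeomorphism (chart_dom c) (chart_image c) (chart_map c) (chart_inv c)"
    and smooth_transition:
      "c \<in> A \<Longrightarrow> d \<in> A \<Longrightarrow>
         smooth_on_open (chart_map c ` (chart_dom c \<inter> chart_dom d)) (transition c d)"

text \<open>The metric is given by its Gram matrices: \<open>g c p\<close> is the matrix of the inner product on the
  tangent space at \<open>p\<close> with respect to the coordinate basis of the chart \<open>c\<close>. The transformation
  law says that these matrices describe one and the same bilinear form.\<close>

type_synonym ('a, 'n) metric_tensor = "('a, 'n) chart \<Rightarrow> 'a \<Rightarrow> real ^ 'n ^ 'n"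

locale riemannian_manifold = smooth_manifold A
  for A :: "('a::{t2_space, second_countable_topology}, 'n::finite) chart set" +
  fixes g :: "('a, 'n) metric_tensor"
  assumes metric_smooth: "c \<in> A \<Longrightarrow> smooth_on_open (chart_image c) (\<lambda>y. g c (chart_inv c y))"
    and metric_sym: "c \<in> A \<Longrightarrow> p \<in> chart_dom c \<Longrightarrow> transpose (g c p) = g c p"
    and metric_pos: "c \<in> A \<Longrightarrow> p \<in> chart_dom c \<Longrightarrow> v \<noteq> 0 \<Longrightarrow> v \<bullet> (g c p *v v) > 0"
    and metric_transform:
      "c \<in> A \<Longrightarrow> d \<in> A \<Longrightarrow> p \<in> chart_dom c \<Longrightarrow> p \<in> chart_dom d \<Longrightarrow>
         J = matrix (frechet_derivative (transition c d) (at (chart_map c p))) \<Longrightarrow>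
         g c p = transpose J ** g d p ** J"

section \<open>Gradient and divergence\<close>

text \<open>Vectors and vector fields are represented by their components in a chart \<open>c\<close>. Scalars built
  from them do not depend on the choice of the chart.\<close>

definition pd :: "('a, 'n::finite) chart \<Rightarrow> 'n \<Rightarrow> ('a \<Rightarrow> real) \<Rightarrow> 'a \<Rightarrow> real" where
  "pd c i u p = frechet_derivative (u \<circ> chart_inv c) (at (chart_map c p)) (axis i 1)"

definition gradient ::
    "('a, 'n::finite) metric_tensor \<Rightarrow> ('a, 'n) chart \<Rightarrow> ('a \<Rightarrow> real) \<Rightarrow> 'a \<Rightarrow> real ^ 'n" where
  "gradient g c u p = matrix_inv (g c p) *v (\<chi> i. pd c i u p)"

definition vlength ::
    "('a, 'n::finite) metric_tensor \<Rightarrow> ('a, 'n) chart \<Rightarrow> 'a \<Rightarrow> real ^ 'n \<Rightarrow> real" where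
  "vlength g c p v = sqrt (v \<bullet> (g c p *v v))"

text \<open>Christoffel symbols of the Levi-Civita connection; the upper index comes first.\<close>

definition christoffel ::
    "('a, 'n::finite) metric_tensor \<Rightarrow> ('a, 'n) chart \<Rightarrow> 'n \<Rightarrow> 'n \<Rightarrow> 'n \<Rightarrow> 'a \<Rightarrow> real" where
  "christoffel g c k i j p =
     (\<Sum>l\<in>UNIV. matrix_inv (g c p) $ k $ l *
        (pd c i (\<lambda>q. g c q $ j $ l) p + pd c j (\<lambda>q. g c q $ i $ l) p
          - pd c l (\<lambda>q. g c q $ i $ j) p)) / 2"

text \<open>The \<open>k\<close>-th component of the covariant derivative of \<open>X\<close> in the \<open>i\<close>-th coordinate direction;
  the divergence is the trace of the covariant derivative.\<close>

definition cov_deriv ::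
    "('a, 'n::finite) metric_tensor \<Rightarrow> ('a, 'n) chart \<Rightarrow> 'n \<Rightarrow> ('a \<Rightarrow> real ^ 'n) \<Rightarrow> 'n \<Rightarrow> 'a \<Rightarrow> real" where
  "cov_deriv g c i X k p =
     pd c i (\<lambda>q. X q $ k) p + (\<Sum>j\<in>UNIV. christoffel g c k i j p * X p $ j)"

definition divergence ::
    "('a, 'n::finite) metric_tensor \<Rightarrow> ('a, 'n) chart \<Rightarrow> ('a \<Rightarrow> real ^ 'n) \<Rightarrow> 'a \<Rightarrow> real" where
  "divergence g c X p = (\<Sum>i\<in>UNIV. cov_deriv g c i X i p)"

section \<open>Smooth barriers\<close>

definition smooth_spacetime ::
    "('a, 'n::finite) chart set \<Rightarrow> real \<Rightarrow> real \<Rightarrow> ('a \<Rightarrow> real \<Rightarrow> real) \<Rightarrow> bool" where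
  "smooth_spacetime A a b f \<longleftrightarrow>
     (\<forall>c\<in>A. smooth_on_set (chart_image c \<times> {a..b}) (\<lambda>(y, t). f (chart_inv c y) t))"

text \<open>\<open>K\<close> is a smooth barrier if this holds for some \<open>f\<close>.\<close>

definition barrier_via ::
    "('a, 'n::finite) chart set \<Rightarrow> ('a, 'n) metric_tensor \<Rightarrow> real \<Rightarrow> real \<Rightarrow>
     (real \<Rightarrow> 'a set) \<Rightarrow> ('a \<Rightarrow> real \<Rightarrow> real) \<Rightarrow> bool" where
  "barrier_via A g a b K f \<longleftrightarrow>
     smooth_spacetime A a b f \<and>
     (\<forall>t\<in>{a..b}. K t = {x. f x t \<le> 0}) \<and>
     (\<forall>t\<in>{a..b}. \<forall>x. f x t = 0 \<longrightarrow>
        (\<forall>c\<in>A. x \<in> chart_dom c \<longrightarrow> gradient g c (\<lambda>q. f q t) x \<noteq> 0))"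

definition compact_family :: "real \<Rightarrow> real \<Rightarrow> (real \<Rightarrow> 'a::topological_space set) \<Rightarrow> bool" where
  "compact_family a b K \<longleftrightarrow> compact (\<Union>t\<in>{a..b}. K t)"

definition unit_normal ::
    "('a, 'n::finite) metric_tensor \<Rightarrow> ('a, 'n) chart \<Rightarrow> ('a \<Rightarrow> real \<Rightarrow> real) \<Rightarrow> real \<Rightarrow> 'a \<Rightarrow> real ^ 'n" where
  "unit_normal g c f t x =
     gradient g c (\<lambda>q. f q t) x /\<^sub>R vlength g c x (gradient g c (\<lambda>q. f q t) x)"

definition mean_curv ::
    "('a, 'n::finite) metric_tensor \<Rightarrow> ('a, 'n) chart \<Rightarrow> ('a \<Rightarrow> real \<Rightarrow> real) \<Rightarrow> 'a \<Rightarrow> real \<Rightarrow> real" where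
  "mean_curv g c f x t = - divergence g c (unit_normal g c f t) x"

text \<open>The time derivative is taken within \<open>[a,b]\<close>, hence one-sided at the end points.\<close>

definition normal_velocity ::
    "('a, 'n::finite) metric_tensor \<Rightarrow> ('a, 'n) chart \<Rightarrow> real \<Rightarrow> real \<Rightarrow>
     ('a \<Rightarrow> real \<Rightarrow> real) \<Rightarrow> 'a \<Rightarrow> real \<Rightarrow> real" where
  "normal_velocity g c a b f x t =
     - vector_derivative (f x) (at t within {a..b}) / vlength g c x (gradient g c (\<lambda>q. f q t) x)"

definition Phi ::
    "('a, 'n::finite) metric_tensor \<Rightarrow> ('a, 'n) chart \<Rightarrow> real \<Rightarrow> real \<Rightarrow>
     ('a \<Rightarrow> real \<Rightarrow> real) \<Rightarrow> 'a \<Rightarrow> real \<Rightarrow> real" where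
  "Phi g c a b f x t = normal_velocity g c a b f x t - mean_curv g c f x t"

section \<open>Weak set flows\<close>

definition slice :: "('a \<times> real) set \<Rightarrow> real \<Rightarrow> 'a set" where
  "slice Z t = {x. (x, t) \<in> Z}"

text \<open>On the boundary of a barrier \<open>K\<close> the value of \<^const>\<open>Phi\<close> depends neither on the function
  \<open>f\<close> defining \<open>K\<close> nor on the chart, so that quantifying over both expresses a condition on \<open>K\<close>.\<close>

definition weak_set_flow ::
    "('a::topological_space, 'n::finite) chart set \<Rightarrow> ('a, 'n) metric_tensor \<Rightarrow> ('a \<times> real) set \<Rightarrow> bool" where
  "weak_set_flow A g Z \<longleftrightarrow>
     closed Z \<and> Z \<subseteq> UNIV \<times> {0..} \<and>
     (\<forall>a b K f p.
        0 \<le> a \<and> a < b \<and> barrier_via A g a b K f \<and> compact_family a b K \<and>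
        (\<forall>t\<in>{a..<b}. K t \<inter> slice Z t = {}) \<and> p \<in> K b \<inter> slice Z b \<longrightarrow>
        p \<in> frontier (K b) \<and>
        (\<forall>c\<in>A. p \<in> chart_dom c \<longrightarrow> Phi g c a b f p b \<ge> 0))"

end

theory Submission
  imports Defs
begin

text \<open>The biggest flow is the closure \<open>Y\<close> of the union of all weak set flows \<open>Z\<close> with
\<open>Z(0) \<subseteq> C\<close>. It contains all of them by construction, in particular \<open>C \<times> {0}\<close>. What has to be shown is that taking the closure neither
creates new points at time \<open>0\<close> nor destroys the barrier condition. Both facts rest on uniform
versions of the avoidance of barriers, uniform in the flow \<open>Z\<close>.

The first one is \<open>shrinking_ball_barrier\<close>. A small coordinate ball that shrinks fast enough
is a barrier with \<open>\<Phi> < 0\<close> along its whole boundary, so that no weak set flow that is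
disjoint from it initially can ever touch it (\<open>first_contact\<close>). Hence, if a flow misses an open set
\<open>U\<close> at some time, then it misses a neighbourhood of a given point of \<open>U\<close> during a time span
that depends on \<open>U\<close> and the point only. At time \<open>0\<close> and with \<open>U\<close> the complement of \<open>C\<close> this
gives \<open>Y(0) = C\<close>. Shortly before time \<open>b\<close>, inside a barrier \<open>K\<close> that avoids \<open>Y\<close> up to time \<open>b\<close>,
it shows that \<open>Y(b)\<close> does not meet the interior of \<open>K(b)\<close> (\<open>no_interior_contact\<close>).

The second one concerns a contact point \<open>p\<close> on the boundary of \<open>K(b)\<close> (\<open>boundary_contact\<close>). Suppose
that \<open>\<Phi> < 0\<close> there. Let \<open>K(t)\<close> be given by \<open>f \<le> 0\<close>, and let \<open>\<psi>\<close> be a bump function in a chart with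
its unique maximum \<open>m\<close> at \<open>p\<close>. The region given by
\<open>f(x,t) + \<epsilon> (m - \<psi>(x) + b - t) - \<delta> \<psi>(x) \<le> 0\<close>
is again a barrier for small \<open>\<epsilon>\<close> and \<open>\<delta>\<close> (\<open>barrier_perturbation\<close>). For \<open>\<delta> = 0\<close> it meets \<open>Y\<close>
only in the space-time point \<open>(p,b)\<close>; for \<open>\<delta> > 0\<close> it contains a neighbourhood of \<open>p\<close> at time
\<open>b\<close>, so that after a small shift in time it is hit by one of the flows \<open>Z\<close>. As \<open>\<delta>\<close> tends to \<open>0\<close>,
the points of first contact with these flows converge to \<open>(p,b)\<close>. They satisfy \<open>\<Phi> \<ge> 0\<close>, while
\<open>\<Phi>\<close> is close to its negative value for \<open>f\<close> at \<open>(p,b)\<close>, a contradiction.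

The analytic input is therefore the continuous dependence of \<open>\<Phi>\<close> on the point, the time and the
parameters \<open>\<epsilon>\<close> and \<open>\<delta>\<close> (\<open>mean_curvature_coordinates\<close>), and the existence of smooth bump
functions on the manifold (\<open>smooth_bump\<close>).\<close>

section \<open>Calculus of smooth maps\<close>

lemma frechet_derivative_cong_open:
  assumes "open S" "x \<in> S" "\<And>y. y \<in> S \<Longrightarrow> f y = g y"
  shows "frechet_derivative f (at x) = frechet_derivative g (at x)"
proof -
  have "(f has_derivative D) (at x) \<longleftrightarrow> (g has_derivative D) (at x)" for D
    using assms has_derivative_transform_within_open[of f D x UNIV S g]
      has_derivative_transform_within_open[of g D x UNIV S f] by auto
  then show ?thesis by (simp add: frechet_derivative_def)
qed

lemma differentiable_cong_open:
  assumes "open S" "x \<in> S" "\<And>y. y \<in> S \<Longrightarrow> f y = g y"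
  shows "f differentiable (at x) \<longleftrightarrow> g differentiable (at x)"
proof -
  have "(f has_derivative D) (at x) \<longleftrightarrow> (g has_derivative D) (at x)" for D
    using assms has_derivative_transform_within_open[of f D x UNIV S g]
      has_derivative_transform_within_open[of g D x UNIV S f] by auto
  then show ?thesis by (simp add: differentiable_def)
qed

lemma Ck_on_cong:
  assumes "open S" "\<And>y. y \<in> S \<Longrightarrow> f y = g y" "Ck_on k S f"
  shows "Ck_on k S g"
  using assms
proof (induction k arbitrary: f g)
  case 0
  then show ?case using continuous_on_cong[of S S f g] by simp
next
  case (Suc k)
  have "Ck_on k S (\<lambda>x. frechet_derivative g (at x) v)" for v
  proof (rule Suc.IH[of "\<lambda>x. frechet_derivative f (at x) v"])
    show "frechet_derivative f (at y) v = frechet_derivative g (at y) v" if "y \<in> S" for y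
      using frechet_derivative_cong_open[of S y f g] Suc.prems that by auto
  qed (use Suc.prems in auto)
  moreover have "g differentiable (at x)" if "x \<in> S" for x
    using differentiable_cong_open[of S x f g] Suc.prems that by auto
  ultimately show ?case by simp
qed

lemma Ck_on_local:
  assumes "\<And>x. x \<in> S \<Longrightarrow> \<exists>W. open W \<and> x \<in> W \<and> Ck_on k W f"
  shows "Ck_on k S f"
  using assms
proof (induction k arbitrary: f)
  case 0
  have "isCont f x" if x: "x \<in> S" for x
  proof -
    obtain W where "open W" "x \<in> W" "continuous_on W f"
      using 0[OF x] by auto
    then show ?thesis by (simp add: continuous_on_eq_continuous_at)
  qed
  then show ?case by (simp add: continuous_at_imp_continuous_on)
next
  case (Suc k)
  have "f differentiable (at x)" if "x \<in> S" for x
    using Suc.prems[OF that] by auto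
  moreover have "Ck_on k S (\<lambda>x. frechet_derivative f (at x) v)" for v
  proof (rule Suc.IH)
    fix x assume "x \<in> S"
    then obtain W where "open W" "x \<in> W" "Ck_on (Suc k) W f"
      using Suc.prems by blast
    then show "\<exists>W. open W \<and> x \<in> W \<and> Ck_on k W (\<lambda>x. frechet_derivative f (at x) v)"
      by auto
  qed
  ultimately show ?case by simp
qed

lemma Ck_on_subset:
  assumes "Ck_on k S f" "T \<subseteq> S"
  shows "Ck_on k T f"
  using assms
  by (induction k arbitrary: f) (auto intro: continuous_on_subset)

lemma Ck_on_imp_continuous_on: "Ck_on k S f \<Longrightarrow> continuous_on S f"
  by (cases k)
    (auto intro!: continuous_at_imp_continuous_on differentiable_imp_continuous_within)

lemma Ck_on_Suc_imp: "Ck_on (Suc k) S f \<Longrightarrow> Ck_on k S f"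
proof (induction k arbitrary: f)
  case 0
  then have "continuous_on S f" by (rule Ck_on_imp_continuous_on)
  then show ?case by simp
qed auto

lemma Ck_on_SucI:
  assumes "open S"
    and "\<And>x. x \<in> S \<Longrightarrow> (f has_derivative D x) (at x)"
    and "\<And>v. Ck_on k S (\<lambda>x. D x v)"
  shows "Ck_on (Suc k) S f"
proof -
  have "Ck_on k S (\<lambda>x. frechet_derivative f (at x) v)" for v
  proof (rule Ck_on_cong[OF assms(1) _ assms(3)[of v]])
    show "D y v = frechet_derivative f (at y) v" if "y \<in> S" for y
      using frechet_derivative_at[OF assms(2)[OF that]] by simp
  qed
  then show ?thesis using assms(2) by (auto simp: differentiable_def)
qed

lemma Ck_on_has_derivative:
  "Ck_on (Suc k) S f \<Longrightarrow> x \<in> S \<Longrightarrow> (f has_derivative frechet_derivative f (at x)) (at x)"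
  by (simp add: frechet_derivative_works)

lemma Ck_on_const: "open S \<Longrightarrow> Ck_on k S (\<lambda>x. c)"
proof (induction k arbitrary: c)
  case (Suc k)
  then show ?case by (intro Ck_on_SucI[where D = "\<lambda>x v. 0"]) auto
qed simp

lemma Ck_on_bounded_linear:
  assumes "open S" "bounded_linear f"
  shows "Ck_on k S f"
proof (cases k)
  case 0
  then show ?thesis using assms(2) by (simp add: linear_continuous_on)
next
  case (Suc n)
  show ?thesis
    unfolding Suc using assms
    by (intro Ck_on_SucI[where D = "\<lambda>x. f"] Ck_on_const bounded_linear_imp_has_derivative)
qed

lemma Ck_on_linear_compose:
  assumes "bounded_linear L" "open S" "Ck_on k S f"
  shows "Ck_on k S (\<lambda>x. L (f x))"
  using assms(3)
proof (induction k arbitrary: f)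
  case 0
  then show ?case using bounded_linear.continuous_on[OF assms(1)] by auto
next
  case (Suc k)
  show ?case
  proof (rule Ck_on_SucI[OF assms(2)])
    show "((\<lambda>x. L (f x)) has_derivative (\<lambda>v. L (frechet_derivative f (at x) v))) (at x)"
      if "x \<in> S" for x
      using bounded_linear.has_derivative[OF assms(1) Ck_on_has_derivative[OF Suc.prems that]] .
  qed (use Suc in auto)
qed

lemma Ck_on_add:
  assumes "open S" "Ck_on k S f" "Ck_on k S g"
  shows "Ck_on k S (\<lambda>x. f x + g x)"
  using assms(2,3)
proof (induction k arbitrary: f g)
  case 0
  then show ?case by (auto intro: continuous_on_add)
next
  case (Suc k)
  show ?case
  proof (rule Ck_on_SucI[OF assms(1)])
    show "((\<lambda>x. f x + g x) has_derivative
        (\<lambda>v. frechet_derivative f (at x) v + frechet_derivative g (at x) v)) (at x)"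
      if "x \<in> S" for x
      using Suc.prems that by (intro has_derivative_add Ck_on_has_derivative)
  qed (use Suc in auto)
qed

lemma Ck_on_bilinear:
  assumes "bounded_bilinear B" "open S" "Ck_on k S f" "Ck_on k S g"
  shows "Ck_on k S (\<lambda>x. B (f x) (g x))"
  using assms(3,4)
proof (induction k arbitrary: f g)
  case 0
  then show ?case using bounded_bilinear.continuous_on[OF assms(1)] by auto
next
  case (Suc k)
  show ?case
  proof (rule Ck_on_SucI[OF assms(2)])
    show "((\<lambda>x. B (f x) (g x)) has_derivative
        (\<lambda>v. B (f x) (frechet_derivative g (at x) v) + B (frechet_derivative f (at x) v) (g x))) (at x)"
      if "x \<in> S" for x
      using Suc.prems that by (intro bounded_bilinear.FDERIV[OF assms(1)] Ck_on_has_derivative)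
    show "Ck_on k S (\<lambda>x. B (f x) (frechet_derivative g (at x) v) + B (frechet_derivative f (at x) v) (g x))"
      for v
      using Suc.prems Ck_on_Suc_imp[OF Suc.prems(1)] Ck_on_Suc_imp[OF Suc.prems(2)]
      by (intro Ck_on_add assms(2) Suc.IH) simp_all
  qed
qed

lemma Ck_on_sum:
  assumes "open S" "\<And>i. i \<in> I \<Longrightarrow> Ck_on k S (f i)"
  shows "Ck_on k S (\<lambda>x. \<Sum>i\<in>I. f i x)"
  using assms(2)
  by (induction I rule: infinite_finite_induct) (auto intro!: Ck_on_add Ck_on_const assms(1))

text \<open>The chain rule is used in its form with partial derivatives: a directional derivative of the
composition is a sum of products of components of the derivative of \<open>g\<close> with directional
derivatives of \<open>f\<close> in fixed directions, and only such fixed directions occur in the recursion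
that defines \<^const>\<open>Ck_on\<close>.\<close>

lemma Ck_on_compose:
  fixes g :: "'a::real_normed_vector \<Rightarrow> 'b::euclidean_space"
  assumes "open S" "Ck_on k S g" "Ck_on k T f" "g ` S \<subseteq> T"
  shows "Ck_on k S (\<lambda>x. f (g x))"
  using assms(2,3)
proof (induction k arbitrary: f)
  case 0
  then show ?case using assms(4) by (auto intro: continuous_on_compose2)
next
  case (Suc k)
  let ?D = "\<lambda>x v. \<Sum>b\<in>Basis. (frechet_derivative g (at x) v \<bullet> b) *\<^sub>R frechet_derivative f (at (g x)) b"
  show ?case
  proof (rule Ck_on_SucI[OF assms(1)])
    show "((\<lambda>x. f (g x)) has_derivative ?D x) (at x)" if "x \<in> S" for x
    proof -
      let ?df = "frechet_derivative f (at (g x))" and ?dg = "frechet_derivative g (at x)"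
      have f: "(f has_derivative ?df) (at (g x))"
        using Suc.prems(2) that assms(4) by (intro Ck_on_has_derivative) auto
      then interpret df: linear ?df by (rule has_derivative_linear)
      have "?df (?dg v) = ?D x v" for v
      proof -
        have "?df (\<Sum>b\<in>Basis. (?dg v \<bullet> b) *\<^sub>R b) = ?D x v"
          by (simp only: df.sum df.scaleR)
        then show ?thesis by (simp only: euclidean_representation)
      qed
      moreover have "((\<lambda>x. f (g x)) has_derivative (\<lambda>v. ?df (?dg v))) (at x)"
        using has_derivative_compose[OF Ck_on_has_derivative[OF Suc.prems(1) that] f] .
      ultimately show ?thesis by simp
    qed
    show "Ck_on k S (\<lambda>x. ?D x v)" for v
    proof (intro Ck_on_sum assms(1))
      fix b :: 'b
      have "Ck_on k S (\<lambda>x. frechet_derivative f (at (g x)) b)"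
        using Suc.prems(2) by (intro Suc.IH[OF Ck_on_Suc_imp[OF Suc.prems(1)]]) simp
      moreover have "Ck_on k S (\<lambda>x. frechet_derivative g (at x) v \<bullet> b)"
        using Suc.prems by (intro Ck_on_linear_compose[OF bounded_linear_inner_left] assms(1)) auto
      ultimately show "Ck_on k S (\<lambda>x. (frechet_derivative g (at x) v \<bullet> b) *\<^sub>R frechet_derivative f (at (g x)) b)"
        by (intro Ck_on_bilinear[OF bounded_bilinear_scaleR] assms(1))
    qed
  qed
qed

lemma open_nonzero: "open (- {0::real})"
  by (simp add: open_Compl)

lemma Ck_on_inverse: "Ck_on k (- {0}) (inverse :: real \<Rightarrow> real)"
proof (induction k)
  case 0
  then show ?case by (auto intro!: continuous_on_inverse continuous_on_id)
next
  case (Suc k)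
  show ?case
  proof (rule Ck_on_SucI[OF open_nonzero])
    show "((inverse :: real \<Rightarrow> real) has_derivative (\<lambda>v. (inverse x * inverse x) * (- v))) (at x)"
      if "x \<in> - {0}" for x
      using has_derivative_inverse'[of x UNIV] that by (simp add: algebra_simps)
    show "Ck_on k (- {0}) (\<lambda>x::real. (inverse x * inverse x) * (- v))" for v
      by (intro Ck_on_bilinear[OF bounded_bilinear_mult] open_nonzero Suc Ck_on_const)
  qed
qed

lemma Ck_on_sqrt: "Ck_on k {0<..} sqrt"
proof (induction k)
  case 0
  then show ?case by (auto intro!: continuous_on_real_sqrt continuous_on_id)
next
  case (Suc k)
  show ?case
  proof (rule Ck_on_SucI)
    show "(sqrt has_derivative (\<lambda>v. inverse (sqrt x) * (v / 2))) (at x)" if "x \<in> {0<..}" for x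
    proof (rule has_derivative_eq_rhs)
      show "(sqrt has_derivative (*) (inverse (sqrt x) / 2)) (at x)"
        using DERIV_real_sqrt[of x] that by (simp add: has_field_derivative_def)
    qed (simp add: fun_eq_iff)
    have "Ck_on k {0<..} (\<lambda>x. inverse (sqrt x))"
      by (rule Ck_on_compose[OF _ Suc Ck_on_inverse]) auto
    then show "Ck_on k {0<..} (\<lambda>x. inverse (sqrt x) * (v / 2))" for v
      by (intro Ck_on_bilinear[OF bounded_bilinear_mult] Ck_on_const) auto
  qed auto
qed

lemma smooth_on_open_imp_open: "smooth_on_open S f \<Longrightarrow> open S"
  and smooth_on_open_imp_Ck_on: "smooth_on_open S f \<Longrightarrow> Ck_on k S f"
  by (auto simp: smooth_on_open_def)

lemma smooth_on_open_imp_continuous_on: "smooth_on_open S f \<Longrightarrow> continuous_on S f"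
  using Ck_on_imp_continuous_on smooth_on_open_imp_Ck_on by blast

lemma smooth_on_open_has_derivative:
  "smooth_on_open S f \<Longrightarrow> x \<in> S \<Longrightarrow> (f has_derivative frechet_derivative f (at x)) (at x)"
  using Ck_on_has_derivative smooth_on_open_imp_Ck_on by blast

lemma smooth_on_open_frechet_derivative:
  assumes "smooth_on_open S f"
  shows "smooth_on_open S (\<lambda>x. frechet_derivative f (at x) v)"
  unfolding smooth_on_open_def
proof (intro conjI allI)
  fix k
  show "Ck_on k S (\<lambda>x. frechet_derivative f (at x) v)"
    using smooth_on_open_imp_Ck_on[OF assms, of "Suc k"] by simp
qed (use assms in \<open>simp add: smooth_on_open_def\<close>)

lemma smooth_on_open_cong:
  "smooth_on_open S f \<Longrightarrow> (\<And>y. y \<in> S \<Longrightarrow> f y = g y) \<Longrightarrow> smooth_on_open S g"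
  using Ck_on_cong[of S f g] by (auto simp: smooth_on_open_def)

lemma smooth_on_open_subset:
  "smooth_on_open S f \<Longrightarrow> open T \<Longrightarrow> T \<subseteq> S \<Longrightarrow> smooth_on_open T f"
  unfolding smooth_on_open_def by (meson Ck_on_subset)

lemma smooth_on_open_local:
  assumes "\<And>x. x \<in> S \<Longrightarrow> \<exists>W. x \<in> W \<and> W \<subseteq> S \<and> smooth_on_open W f"
  shows "smooth_on_open S f"
  unfolding smooth_on_open_def
proof (intro conjI allI)
  show "open S"
    using assms unfolding open_subopen[of S] by (meson smooth_on_open_imp_open)
  show "Ck_on k S f" for k
    by (rule Ck_on_local) (meson assms smooth_on_open_def)
qed

lemma smooth_on_open_const: "open S \<Longrightarrow> smooth_on_open S (\<lambda>x. c)"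
  by (simp add: smooth_on_open_def Ck_on_const)

lemma smooth_on_open_bounded_linear: "open S \<Longrightarrow> bounded_linear f \<Longrightarrow> smooth_on_open S f"
  by (simp add: smooth_on_open_def Ck_on_bounded_linear)

lemma smooth_on_open_linear_compose:
  "bounded_linear L \<Longrightarrow> smooth_on_open S f \<Longrightarrow> smooth_on_open S (\<lambda>x. L (f x))"
  by (simp add: smooth_on_open_def Ck_on_linear_compose)

lemma smooth_on_open_add:
  "smooth_on_open S f \<Longrightarrow> smooth_on_open S g \<Longrightarrow> smooth_on_open S (\<lambda>x. f x + g x)"
  by (simp add: smooth_on_open_def Ck_on_add)

lemma smooth_on_open_diff:
  "smooth_on_open S f \<Longrightarrow> smooth_on_open S g \<Longrightarrow> smooth_on_open S (\<lambda>x. f x - g x)"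
  using smooth_on_open_add[of S f "\<lambda>x. - g x"]
    smooth_on_open_linear_compose[OF bounded_linear_minus[OF bounded_linear_ident], of S g] by simp

lemma smooth_on_open_bilinear:
  "bounded_bilinear B \<Longrightarrow> smooth_on_open S f \<Longrightarrow> smooth_on_open S g \<Longrightarrow>
    smooth_on_open S (\<lambda>x. B (f x) (g x))"
  by (simp add: smooth_on_open_def Ck_on_bilinear)

lemmas smooth_on_open_mult = smooth_on_open_bilinear[OF bounded_bilinear_mult]
  and smooth_on_open_scaleR = smooth_on_open_bilinear[OF bounded_bilinear_scaleR]
  and smooth_on_open_inner = smooth_on_open_bilinear[OF bounded_bilinear_inner]
  and smooth_on_open_vec_nth = smooth_on_open_linear_compose[OF bounded_linear_vec_nth]

lemma smooth_on_open_sum: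
  "open S \<Longrightarrow> (\<And>i. i \<in> I \<Longrightarrow> smooth_on_open S (f i)) \<Longrightarrow>
    smooth_on_open S (\<lambda>x. \<Sum>i\<in>I. f i x)"
  by (simp add: smooth_on_open_def Ck_on_sum)

lemma smooth_on_open_prod:
  fixes f :: "'i \<Rightarrow> 'a::real_normed_vector \<Rightarrow> real"
  assumes "open S" "\<And>i. i \<in> I \<Longrightarrow> smooth_on_open S (f i)"
  shows "smooth_on_open S (\<lambda>x. \<Prod>i\<in>I. f i x)"
  using assms(2)
  by (induction I rule: infinite_finite_induct)
    (auto intro!: smooth_on_open_mult smooth_on_open_const assms(1))

lemma smooth_on_open_compose:
  fixes g :: "'a::real_normed_vector \<Rightarrow> 'b::euclidean_space"
  assumes "smooth_on_open S g" "smooth_on_open T f" "g ` S \<subseteq> T"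
  shows "smooth_on_open S (\<lambda>x. f (g x))"
  using assms by (auto simp: smooth_on_open_def intro: Ck_on_compose)

lemma smooth_on_open_divide:
  fixes f g :: "'a::real_normed_vector \<Rightarrow> real"
  assumes "smooth_on_open S f" "smooth_on_open S g" "\<And>x. x \<in> S \<Longrightarrow> g x \<noteq> 0"
  shows "smooth_on_open S (\<lambda>x. f x / g x)"
proof -
  have "smooth_on_open (- {0}) (inverse :: real \<Rightarrow> real)"
    by (simp add: smooth_on_open_def open_nonzero Ck_on_inverse)
  then have "smooth_on_open S (\<lambda>x. inverse (g x))"
    by (rule smooth_on_open_compose[OF assms(2)]) (use assms(3) in auto)
  from smooth_on_open_mult[OF assms(1) this] show ?thesis by (simp add: divide_inverse)
qed

lemma smooth_on_open_sqrt:
  assumes "smooth_on_open S f" "\<And>x. x \<in> S \<Longrightarrow> f x > 0"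
  shows "smooth_on_open S (\<lambda>x. sqrt (f x))"
  using smooth_on_open_compose[OF assms(1), of "{0<..}" sqrt] assms(2) Ck_on_sqrt
  by (auto simp: smooth_on_open_def)

lemma smooth_on_open_vec_lambda:
  fixes f :: "'i::finite \<Rightarrow> 'a::real_normed_vector \<Rightarrow> real"
  assumes "open S" "\<And>i. smooth_on_open S (f i)"
  shows "smooth_on_open S (\<lambda>x. \<chi> i. f i x)"
proof -
  have "(\<chi> i. f i x) = (\<Sum>i\<in>UNIV. f i x *\<^sub>R axis i 1)" for x
    by (simp add: vec_eq_iff axis_def if_distrib cong: if_cong)
  then show ?thesis
    by (auto intro!: smooth_on_open_sum smooth_on_open_scaleR smooth_on_open_const assms)
qed

lemma smooth_on_open_det:
  fixes M :: "'a::real_normed_vector \<Rightarrow> real ^ 'n ^ 'n"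
  assumes "open S" "\<And>i j. smooth_on_open S (\<lambda>x. M x $ i $ j)"
  shows "smooth_on_open S (\<lambda>x. det (M x))"
  unfolding det_def
  by (intro smooth_on_open_sum smooth_on_open_mult smooth_on_open_const smooth_on_open_prod assms)

section \<open>The flat function\<close>

text \<open>The functions \<open>exp (-1/t) / t^k\<close>, extended by \<open>0\<close>: the classical smooth function with \<open>k = 0\<close>
together with the powers of \<open>1/t\<close> that its derivatives produce.\<close>

definition flat :: "nat \<Rightarrow> real \<Rightarrow> real" where
  "flat k t = (if t \<le> 0 then 0 else inverse t ^ k * exp (- inverse t))"

lemma flat_tendsto_0: "(flat k \<longlongrightarrow> 0) (at 0)"
proof -
  have "((\<lambda>t::real. inverse t ^ k / exp (inverse t)) \<longlongrightarrow> 0) (at_right 0)"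
    using filterlim_compose[OF tendsto_power_div_exp_0 filterlim_inverse_at_top_right] .
  then have "(flat k \<longlongrightarrow> 0) (at_right 0)"
    by (rule Lim_transform_eventually)
      (auto simp: flat_def exp_minus field_simps eventually_at_filter)
  moreover have "(flat k \<longlongrightarrow> 0) (at_left 0)"
    by (rule Lim_transform_eventually[OF tendsto_const]) (auto simp: flat_def eventually_at_filter)
  ultimately show ?thesis by (simp add: filterlim_split_at)
qed

text \<open>The family is closed under differentiation up to linear combinations, so a single differentiability
statement yields all higher derivatives. At \<open>0\<close> the difference quotient is the next member of the
family, which tends to \<open>0\<close>.\<close>

lemma DERIV_flat:
  "(flat k has_real_derivative flat (k + 2) t - real k * flat (k + 1) t) (at t)"
proof -
  consider "t < 0" | "t = 0" | "t > 0" by linarith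
  then show ?thesis
  proof cases
    case 1
    have "((\<lambda>t. 0) has_real_derivative 0) (at t)" by simp
    then have "(flat k has_real_derivative 0) (at t)"
      by (rule DERIV_cong_ev[THEN iffD1, rotated -1])
        (use 1 eventually_nhds_in_open[of "{..<0}" t] in \<open>auto simp: flat_def elim: eventually_mono\<close>)
    then show ?thesis using 1 by (simp add: flat_def)
  next
    case 2
    have "((\<lambda>h. (flat k (0 + h) - flat k 0) / h) \<longlongrightarrow> 0) (at 0)"
      by (rule Lim_transform_eventually[OF flat_tendsto_0[of "k + 1"]])
        (auto simp: flat_def field_simps eventually_at_filter)
    then show ?thesis using 2 by (simp add: DERIV_def) (simp add: flat_def)
  next
    case 3
    have "((\<lambda>t. inverse t ^ k * exp (- inverse t)) has_real_derivative
        flat (k + 2) t - real k * flat (k + 1) t) (at t)"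
    proof -
      have "((\<lambda>t. inverse t ^ k) has_real_derivative
          real k * (inverse t ^ (k - 1) * - (inverse t ^ 2))) (at t)"
        using 3 by (auto intro!: derivative_eq_intros simp: power2_eq_square)
      moreover have "((\<lambda>t. exp (- inverse t)) has_real_derivative exp (- inverse t) * inverse t ^ 2) (at t)"
        using 3 by (auto intro!: derivative_eq_intros simp: power2_eq_square)
      ultimately
      have "((\<lambda>t. inverse t ^ k * exp (- inverse t)) has_real_derivative
          inverse t ^ k * (exp (- inverse t) * inverse t ^ 2) +
          real k * (inverse t ^ (k - 1) * - (inverse t ^ 2)) * exp (- inverse t)) (at t)"
        by (rule DERIV_mult')
      then show ?thesis
        using 3 by (elim DERIV_cong, cases k) (simp_all add: flat_def power2_eq_square algebra_simps)
    qed
    then show ?thesis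
      by (rule DERIV_cong_ev[THEN iffD1, rotated -1])
        (use 3 eventually_nhds_in_open[of "{0<..}" t] in \<open>auto simp: flat_def elim: eventually_mono\<close>)
  qed
qed

lemma Ck_on_flat: "Ck_on n UNIV (flat k)"
proof (induction n arbitrary: k)
  case 0
  show ?case using DERIV_isCont[OF DERIV_flat[of k]] by (simp add: continuous_at_imp_continuous_on)
next
  case (Suc n)
  show ?case
  proof (rule Ck_on_SucI[OF open_UNIV])
    show "(flat k has_derivative (\<lambda>v. (flat (k + 2) t + (- real k) * flat (k + 1) t) * v)) (at t)" for t
      using DERIV_flat[of k t] by (simp add: has_field_derivative_def)
    show "Ck_on n UNIV (\<lambda>t. (flat (k + 2) t + (- real k) * flat (k + 1) t) * v)" for v
      by (intro Ck_on_bilinear[OF bounded_bilinear_mult] Ck_on_add Ck_on_const Suc open_UNIV)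
  qed
qed

lemma smooth_on_open_flat: "smooth_on_open UNIV (flat k)"
  by (simp add: smooth_on_open_def Ck_on_flat)

lemma flat_0_nonneg: "flat 0 t \<ge> 0"
  by (simp add: flat_def)

lemma flat_0_strict_mono: "0 < t \<Longrightarrow> s < t \<Longrightarrow> flat 0 s < flat 0 t"
  by (auto simp: flat_def)

section \<open>Charts\<close>

lemma homeomorphism_chart_simps:
  assumes "homeomorphism (chart_dom c) (chart_image c) (chart_map c) (chart_inv c)"
  shows "x \<in> chart_dom c \<Longrightarrow> chart_inv c (chart_map c x) = x"
    and "y \<in> chart_image c \<Longrightarrow> chart_map c (chart_inv c y) = y"
    and "x \<in> chart_dom c \<Longrightarrow> chart_map c x \<in> chart_image c"
    and "y \<in> chart_image c \<Longrightarrow> chart_inv c y \<in> chart_dom c"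
  using assms by (auto simp: homeomorphism_def)

lemma smooth_slice_has_derivative:
  assumes "smooth_on_open W H" "(y, s) \<in> W"
  shows "((\<lambda>y'. H (y', s)) has_derivative (\<lambda>v. frechet_derivative H (at (y, s)) (v, 0))) (at y)"
proof -
  have "((\<lambda>y'. (y', s)) has_derivative (\<lambda>v. (v, 0))) (at y)"
    by (auto intro!: derivative_eq_intros)
  from has_derivative_compose[OF this smooth_on_open_has_derivative[OF assms]] show ?thesis .
qed

lemma smooth_slice_has_derivative_snd:
  assumes "smooth_on_open W H" "(y, s) \<in> W"
  shows "((\<lambda>s'. H (y, s')) has_derivative (\<lambda>v. frechet_derivative H (at (y, s)) (0, v))) (at s)"
proof -
  have "((\<lambda>s'. (y, s')) has_derivative (\<lambda>v. (0, v))) (at s)"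
    by (auto intro!: derivative_eq_intros)
  from has_derivative_compose[OF this smooth_on_open_has_derivative[OF assms]] show ?thesis .
qed

lemma open_slice:
  assumes "open W"
  shows "open {y. (y, s) \<in> W}"
proof -
  have "open ((\<lambda>y. (y, s)) -` W)"
    by (intro open_vimage assms continuous_intros)
  then show ?thesis by (simp add: vimage_def)
qed

context smooth_manifold
begin

lemmas chart_inv_map = homeomorphism_chart_simps(1)[OF chart_homeomorphism]
  and chart_map_inv = homeomorphism_chart_simps(2)[OF chart_homeomorphism]
  and chart_map_in = homeomorphism_chart_simps(3)[OF chart_homeomorphism]
  and chart_inv_in = homeomorphism_chart_simps(4)[OF chart_homeomorphism]

lemma chart_at:
  obtains c where "c \<in> A" "x \<in> chart_dom c"
  using atlas_cover by blast

lemma continuous_on_chart_map: "c \<in> A \<Longrightarrow> continuous_on (chart_dom c) (chart_map c)"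
  and continuous_on_chart_inv: "c \<in> A \<Longrightarrow> continuous_on (chart_image c) (chart_inv c)"
  using chart_homeomorphism by (auto simp: homeomorphism_def)

lemma open_chart_inv_vimage:
  assumes "c \<in> A" "open U"
  shows "open {y \<in> chart_image c. chart_inv c y \<in> U}"
  using continuous_open_preimage[OF continuous_on_chart_inv open_chart_image] assms
  by (simp add: vimage_def Int_def conj_commute)

lemma open_chart_map_vimage:
  assumes "c \<in> A" "open W"
  shows "open {x \<in> chart_dom c. chart_map c x \<in> W}"
  using continuous_open_preimage[OF continuous_on_chart_map open_chart_dom] assms
  by (simp add: vimage_def Int_def conj_commute)

lemma open_overlap:
  assumes "c \<in> A" "d \<in> A"
  shows "open {y \<in> chart_image d. chart_inv d y \<in> chart_dom c}"
  by (rule open_chart_inv_vimage) (use assms open_chart_dom in auto)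

lemma smooth_transition_overlap:
  assumes "c \<in> A" "d \<in> A"
  shows "smooth_on_open {y \<in> chart_image d. chart_inv d y \<in> chart_dom c} (transition d c)"
proof -
  have "{y \<in> chart_image d. chart_inv d y \<in> chart_dom c} \<subseteq> chart_map d ` (chart_dom d \<inter> chart_dom c)"
    using assms by (auto simp: image_iff) (metis chart_inv_in chart_map_inv IntI)
  then show ?thesis
    using smooth_on_open_subset[OF smooth_transition open_overlap] assms by blast
qed

text \<open>By the chain rule for the change of coordinates. This makes it possible to check the
non-degeneracy of a barrier at each point in a single chart.\<close>

lemma critical_chart_independent:
  assumes cd: "c \<in> A" "d \<in> A" and p: "p \<in> chart_dom c" "p \<in> chart_dom d"
    and u: "((u \<circ> chart_inv c) has_derivative (\<lambda>v. 0)) (at (chart_map c p))"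
  shows "((u \<circ> chart_inv d) has_derivative (\<lambda>v. 0)) (at (chart_map d p))"
proof -
  let ?S = "{y \<in> chart_image d. chart_inv d y \<in> chart_dom c}"
  let ?y = "chart_map d p"
  have y: "?y \<in> ?S" using cd p by (simp add: chart_map_in chart_inv_map)
  have "transition d c ?y = chart_map c p"
    using cd p by (simp add: transition_def chart_inv_map)
  with u have "((u \<circ> chart_inv c) has_derivative (\<lambda>v. 0)) (at (transition d c ?y))" by simp
  from has_derivative_compose[OF smooth_on_open_has_derivative[OF smooth_transition_overlap[OF cd] y] this]
  have "((\<lambda>y. (u \<circ> chart_inv c) (transition d c y)) has_derivative (\<lambda>v. 0)) (at ?y)" by simp
  then show ?thesis
    by (rule has_derivative_transform_within_open[OF _ open_overlap[OF cd] y])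
      (use cd in \<open>auto simp: transition_def chart_inv_map\<close>)
qed

section \<open>Smooth functions on space-time\<close>

lemma smooth_on_set_add:
  assumes "smooth_on_set S f" "smooth_on_set S g"
  shows "smooth_on_set S (\<lambda>x. f x + g x)"
  unfolding smooth_on_set_def
proof
  fix z assume z: "z \<in> S"
  obtain W h where h: "z \<in> W" "smooth_on_open W h" "\<forall>w\<in>W \<inter> S. h w = f w"
    using assms(1) z unfolding smooth_on_set_def by blast
  obtain W' h' where h': "z \<in> W'" "smooth_on_open W' h'" "\<forall>w\<in>W' \<inter> S. h' w = g w"
    using assms(2) z unfolding smooth_on_set_def by blast
  have o: "open (W \<inter> W')" using h h' by (auto dest: smooth_on_open_imp_open)
  have "smooth_on_open (W \<inter> W') (\<lambda>w. h w + h' w)"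
    using smooth_on_open_subset[OF h(2) o] smooth_on_open_subset[OF h'(2) o]
    by (intro smooth_on_open_add) auto
  then show "\<exists>W h. z \<in> W \<and> smooth_on_open W h \<and> (\<forall>w\<in>W \<inter> S. h w = f w + g w)"
    using h h' by (intro exI[of _ "W \<inter> W'"] exI[of _ "\<lambda>w. h w + h' w"]) auto
qed

lemma smooth_on_set_subset:
  assumes "smooth_on_set S f" "T \<subseteq> S"
  shows "smooth_on_set T f"
  unfolding smooth_on_set_def
proof
  fix z assume "z \<in> T"
  then have "z \<in> S" using assms(2) by blast
  then obtain W h where "z \<in> W" "smooth_on_open W h" "\<forall>w\<in>W \<inter> S. h w = f w"
    using assms(1) unfolding smooth_on_set_def by blast
  then show "\<exists>W h. z \<in> W \<and> smooth_on_open W h \<and> (\<forall>w\<in>W \<inter> T. h w = f w)"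
    using assms(2) by blast
qed

lemma smooth_on_set_cmult:
  fixes f :: "'c::real_normed_vector \<Rightarrow> real"
  assumes "smooth_on_set S f"
  shows "smooth_on_set S (\<lambda>x. k * f x)"
  unfolding smooth_on_set_def
proof
  fix z assume z: "z \<in> S"
  obtain W h where h: "z \<in> W" "smooth_on_open W h" "\<forall>w\<in>W \<inter> S. h w = f w"
    using assms(1) z unfolding smooth_on_set_def by blast
  then show "\<exists>W h. z \<in> W \<and> smooth_on_open W h \<and> (\<forall>w\<in>W \<inter> S. h w = k * f w)"
    using smooth_on_open_linear_compose[OF bounded_linear_mult_right[of k] h(2)]
    by (intro exI[of _ W] exI[of _ "\<lambda>w. k * h w"]) auto
qed

lemma smooth_spacetime_add:
  assumes "smooth_spacetime A a b f" "smooth_spacetime A a b f'"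
  shows "smooth_spacetime A a b (\<lambda>x t. f x t + f' x t)"
  unfolding smooth_spacetime_def
proof
  fix c assume c: "c \<in> A"
  have "smooth_on_set (chart_image c \<times> {a..b})
      (\<lambda>w. (\<lambda>(y, t). f (chart_inv c y) t) w + (\<lambda>(y, t). f' (chart_inv c y) t) w)"
    using assms c by (intro smooth_on_set_add) (auto simp: smooth_spacetime_def)
  then show "smooth_on_set (chart_image c \<times> {a..b})
      (\<lambda>(y, t). f (chart_inv c y) t + f' (chart_inv c y) t)"
    by (simp add: case_prod_unfold)
qed

lemma smooth_spacetime_cmult:
  assumes "smooth_spacetime A a b f"
  shows "smooth_spacetime A a b (\<lambda>x t. k * f x t)"
  unfolding smooth_spacetime_def
proof
  fix c assume c: "c \<in> A"
  have "smooth_on_set (chart_image c \<times> {a..b}) (\<lambda>w. k * (\<lambda>(y, t). f (chart_inv c y) t) w)"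
    using assms c by (intro smooth_on_set_cmult) (auto simp: smooth_spacetime_def)
  then show "smooth_on_set (chart_image c \<times> {a..b}) (\<lambda>(y, t). k * f (chart_inv c y) t)"
    by (simp add: case_prod_unfold)
qed

lemma smooth_spacetime_space:
  assumes "\<And>c. c \<in> A \<Longrightarrow> smooth_on_open (chart_image c) (\<lambda>y. u (chart_inv c y))"
  shows "smooth_spacetime A a b (\<lambda>x t. u x)"
  unfolding smooth_spacetime_def smooth_on_set_def
proof (intro ballI)
  fix c z assume c: "c \<in> A" and z: "z \<in> chart_image c \<times> {a..b}"
  have o: "open (chart_image c \<times> (UNIV :: real set))"
    using c open_chart_image open_Times by blast
  have "smooth_on_open (chart_image c \<times> (UNIV :: real set)) (\<lambda>w. u (chart_inv c (fst w)))"
    by (rule smooth_on_open_compose[OF smooth_on_open_bounded_linear[OF o bounded_linear_fst] assms[OF c]]) auto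
  then show "\<exists>W h. z \<in> W \<and> smooth_on_open W h \<and>
      (\<forall>w\<in>W \<inter> chart_image c \<times> {a..b}. h w = (case w of (y, t) \<Rightarrow> u (chart_inv c y)))"
    using z by (intro exI[of _ "chart_image c \<times> UNIV"] exI) (auto simp: case_prod_beta)
qed

lemma smooth_spacetime_affine: "smooth_spacetime A a b (\<lambda>x t. k + l * t)"
  unfolding smooth_spacetime_def smooth_on_set_def
proof (intro ballI)
  fix c and z :: "(real ^ 'n) \<times> real"
  have "smooth_on_open UNIV (\<lambda>w :: (real ^ 'n) \<times> real. k + l * snd w)"
    by (intro smooth_on_open_add smooth_on_open_const smooth_on_open_mult
        smooth_on_open_bounded_linear bounded_linear_snd open_UNIV)
  then show "\<exists>W h. z \<in> W \<and> smooth_on_open W h \<and>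
      (\<forall>w\<in>W \<inter> chart_image c \<times> {a..b}. h w = (case w of (y, t) \<Rightarrow> k + l * t))"
    by (intro exI[of _ UNIV] exI) (auto simp: case_prod_beta)
qed

lemma smooth_spacetime_subinterval:
  assumes "smooth_spacetime A a b f" "{a'..b'} \<subseteq> {a..b}"
  shows "smooth_spacetime A a' b' f"
  unfolding smooth_spacetime_def
proof
  fix c assume "c \<in> A"
  then have "smooth_on_set (chart_image c \<times> {a..b}) (\<lambda>(y, t). f (chart_inv c y) t)"
    using assms(1) by (simp add: smooth_spacetime_def)
  then show "smooth_on_set (chart_image c \<times> {a'..b'}) (\<lambda>(y, t). f (chart_inv c y) t)"
    by (rule smooth_on_set_subset) (use assms(2) in blast)
qed

lemma smooth_spacetime_shift:
  assumes "smooth_spacetime A a b f"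
  shows "smooth_spacetime A (a + s) (b + s) (\<lambda>x t. f x (t - s))"
  unfolding smooth_spacetime_def smooth_on_set_def
proof (intro ballI)
  fix c and z :: "(real ^ 'n) \<times> real"
  assume c: "c \<in> A" and z: "z \<in> chart_image c \<times> {a + s..b + s}"
  let ?T = "\<lambda>w :: (real ^ 'n) \<times> real. w - (0, s)"
  have "?T z \<in> chart_image c \<times> {a..b}" using z by auto
  then obtain W h where h: "?T z \<in> W" "smooth_on_open W h"
    "\<forall>w\<in>W \<inter> chart_image c \<times> {a..b}. h w = (\<lambda>(y, t). f (chart_inv c y) t) w"
    using assms c unfolding smooth_spacetime_def smooth_on_set_def by meson
  have o: "open (?T -` W)"
    by (intro open_vimage smooth_on_open_imp_open[OF h(2)] continuous_intros)
  have T: "smooth_on_open (?T -` W) ?T"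
    by (intro smooth_on_open_diff smooth_on_open_bounded_linear bounded_linear_ident smooth_on_open_const o)
  have "smooth_on_open (?T -` W) (\<lambda>w. h (?T w))"
    by (rule smooth_on_open_compose[OF T h(2)]) auto
  moreover have "\<forall>w\<in>(?T -` W) \<inter> chart_image c \<times> {a + s..b + s}.
      h (?T w) = (case w of (y, t) \<Rightarrow> f (chart_inv c y) (t - s))"
    using h(3) by auto
  ultimately show "\<exists>W h. z \<in> W \<and> smooth_on_open W h \<and>
      (\<forall>w\<in>W \<inter> chart_image c \<times> {a + s..b + s}. h w = (case w of (y, t) \<Rightarrow> f (chart_inv c y) (t - s)))"
    using h(1) by (intro exI[of _ "?T -` W"] exI[of _ "\<lambda>w. h (?T w)"]) auto
qed

text \<open>Functions on space-time are only given for times in \<open>[a,b]\<close>. A local representation is a smooth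
function on an open set of coordinate space-time that agrees with \<open>f\<close> at those times; spatial
derivatives and one-sided time derivatives of \<open>f\<close> are derivatives of \<open>h\<close>.\<close>

definition local_rep :: "('a, 'n) chart \<Rightarrow> real \<Rightarrow> real \<Rightarrow> ('a \<Rightarrow> real \<Rightarrow> real) \<Rightarrow>
    ((real ^ 'n) \<times> real) set \<Rightarrow> ((real ^ 'n) \<times> real \<Rightarrow> real) \<Rightarrow> bool" where
  "local_rep c a b f W h \<longleftrightarrow> smooth_on_open W h \<and> W \<subseteq> chart_image c \<times> UNIV \<and>
     (\<forall>y t. (y, t) \<in> W \<longrightarrow> t \<in> {a..b} \<longrightarrow> f (chart_inv c y) t = h (y, t))"

lemma smooth_spacetime_local_rep:
  assumes f: "smooth_spacetime A a b f" and c: "c \<in> A" and x: "x \<in> chart_dom c" and t: "t \<in> {a..b}"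
  obtains W h where "(chart_map c x, t) \<in> W" "local_rep c a b f W h"
proof -
  have "(chart_map c x, t) \<in> chart_image c \<times> {a..b}"
    using c x t by (simp add: chart_map_in)
  then obtain W h where h: "(chart_map c x, t) \<in> W" "smooth_on_open W h"
    "\<forall>w\<in>W \<inter> chart_image c \<times> {a..b}. h w = (\<lambda>(y, t). f (chart_inv c y) t) w"
    using f c unfolding smooth_spacetime_def smooth_on_set_def by meson
  let ?W = "W \<inter> chart_image c \<times> UNIV"
  have "open ?W"
    using open_chart_image[OF c] smooth_on_open_imp_open[OF h(2)] by (intro open_Int open_Times) auto
  then have "smooth_on_open ?W h" by (rule smooth_on_open_subset[OF h(2)]) auto
  then have "local_rep c a b f ?W h" using h(3) by (auto simp: local_rep_def)
  then show ?thesis using that[of ?W h] h(1) chart_map_in[OF c x] by auto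
qed

lemma local_rep_slice_cong:
  assumes "local_rep c a b f W h" "t \<in> {a..b}" "(y, t) \<in> W"
  shows "open {y'. (y', t) \<in> W}" "y \<in> {y'. (y', t) \<in> W}"
    "\<And>y'. y' \<in> {y'. (y', t) \<in> W} \<Longrightarrow> h (y', t) = ((\<lambda>x. f x t) \<circ> chart_inv c) y'"
  using assms open_slice[of W t] by (auto simp: local_rep_def dest: smooth_on_open_imp_open)

lemma local_rep_has_derivative:
  assumes "local_rep c a b f W h" "t \<in> {a..b}" "(y, t) \<in> W"
  shows "(((\<lambda>x. f x t) \<circ> chart_inv c) has_derivative
    (\<lambda>v. frechet_derivative h (at (y, t)) (v, 0))) (at y)"
proof (rule has_derivative_transform_within_open)
  show "((\<lambda>y'. h (y', t)) has_derivative (\<lambda>v. frechet_derivative h (at (y, t)) (v, 0))) (at y)"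
    by (rule smooth_slice_has_derivative) (use assms in \<open>auto simp: local_rep_def\<close>)
qed (use local_rep_slice_cong[OF assms] in auto)

text \<open>The value does not mention the interval \<open>[a',b']\<close>: this is why shortening a barrier in time leaves
its normal velocity unchanged, also at the new end point.\<close>

lemma local_rep_has_vector_derivative:
  assumes "local_rep c a b f W h" "t \<in> {a'..b'}" "{a'..b'} \<subseteq> {a..b}" "(y, t) \<in> W"
  shows "(f (chart_inv c y) has_vector_derivative frechet_derivative h (at (y, t)) (0, 1))
    (at t within {a'..b'})"
proof -
  let ?D = "frechet_derivative h (at (y, t))"
  have W: "smooth_on_open W h" using assms by (simp add: local_rep_def)
  have D: "((\<lambda>s. h (y, s)) has_derivative (\<lambda>v. ?D (0, v))) (at t)"
    by (rule smooth_slice_has_derivative_snd[OF W assms(4)])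
  have "linear (\<lambda>v. ?D (0, v))" using D by (rule has_derivative_linear)
  then have "?D (0, v) = v *\<^sub>R ?D (0, 1)" for v
    using linear_cmul[of "\<lambda>v. ?D (0, v)" v 1] by simp
  then have "(\<lambda>v. ?D (0, v)) = (\<lambda>v. v *\<^sub>R ?D (0, 1))" by (rule ext)
  from D[unfolded this] have "((\<lambda>s. h (y, s)) has_vector_derivative ?D (0, 1)) (at t)"
    by (simp only: has_vector_derivative_def)
  then have D': "((\<lambda>s. h (y, s)) has_vector_derivative ?D (0, 1)) (at t within {a'..b'})"
    by (rule has_vector_derivative_at_within)
  have "open ((\<lambda>s. (y, s)) -` W)"
    by (intro open_vimage smooth_on_open_imp_open[OF W] continuous_intros)
  then obtain d where d: "d > 0" "\<And>s. dist s t < d \<Longrightarrow> (y, s) \<in> W"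
    unfolding open_dist using assms(4) by (metis vimage_eq)
  have eq: "h (y, s) = f (chart_inv c y) s" if "(y, s) \<in> W" "s \<in> {a'..b'}" for s
    using assms(1,3) that unfolding local_rep_def by auto
  show ?thesis
    using D' unfolding has_vector_derivative_def
    by (rule has_derivative_transform_within[OF _ d(1) assms(2)])
      (use d(2) eq in auto)
qed

lemma smooth_spacetime_has_derivative:
  assumes "smooth_spacetime A a b f" "c \<in> A" "x \<in> chart_dom c" "t \<in> {a..b}"
  obtains D where "(((\<lambda>x. f x t) \<circ> chart_inv c) has_derivative D) (at (chart_map c x))"
proof -
  obtain W h where "(chart_map c x, t) \<in> W" "local_rep c a b f W h"
    by (rule smooth_spacetime_local_rep[OF assms])
  from that[OF local_rep_has_derivative[OF this(2) assms(4) this(1)]] show ?thesis .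
qed

lemma smooth_spacetime_continuous_on:
  assumes "smooth_spacetime A a b f"
  shows "continuous_on (UNIV \<times> {a..b}) (\<lambda>(x, t). f x t)"
  unfolding continuous_on_eq_continuous_within
proof
  fix z :: "'a \<times> real"
  assume z: "z \<in> UNIV \<times> {a..b}"
  obtain c where c: "c \<in> A" "fst z \<in> chart_dom c" by (rule chart_at)
  obtain W h where W: "(chart_map c (fst z), snd z) \<in> W" "local_rep c a b f W h"
  proof (rule smooth_spacetime_local_rep[OF assms c])
    show "snd z \<in> {a..b}" using z by auto
  qed
  let ?\<phi> = "\<lambda>w. (chart_map c (fst w), snd w)"
  have \<phi>: "continuous_on (chart_dom c \<times> UNIV) ?\<phi>"
    by (intro continuous_on_Pair continuous_on_compose2[OF continuous_on_chart_map[OF c(1)]] continuous_intros) auto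
  have oW: "open W" and hW: "continuous_on W h"
    using W by (auto simp: local_rep_def dest: smooth_on_open_imp_open smooth_on_open_imp_continuous_on)
  have o: "open (chart_dom c \<times> (UNIV :: real set))"
    using open_chart_dom[OF c(1)] by (intro open_Times) auto
  then have oN: "open ((chart_dom c \<times> UNIV) \<inter> ?\<phi> -` W)" (is "open ?N")
    by (rule continuous_open_preimage[OF \<phi> _ oW])
  have zN: "z \<in> ?N" using W c by (auto simp: mem_Times_iff)
  have "continuous_on ?N (\<lambda>w. h (?\<phi> w))"
    by (rule continuous_on_compose2[OF hW continuous_on_subset[OF \<phi>]]) auto
  then have "continuous (at z within UNIV \<times> {a..b}) (\<lambda>w. h (?\<phi> w))"
    using oN zN by (meson continuous_at_imp_continuous_at_within continuous_on_eq_continuous_at)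
  moreover have "eventually (\<lambda>w. w \<in> ?N) (at z within UNIV \<times> {a..b})"
    using oN zN eventually_at_topological by blast
  then have "eventually (\<lambda>w. h (?\<phi> w) = (\<lambda>(x, t). f x t) w) (at z within UNIV \<times> {a..b})"
    using W(2) c(1) unfolding eventually_at_filter local_rep_def
    by (auto simp: chart_inv_map elim!: eventually_mono) (metis chart_inv_map)
  moreover have "h (?\<phi> z) = (\<lambda>(x, t). f x t) z"
    using W z c unfolding local_rep_def by (auto simp: chart_inv_map mem_Times_iff case_prod_beta) (metis chart_inv_map)
  ultimately show "continuous (at z within UNIV \<times> {a..b}) (\<lambda>(x, t). f x t)"
    unfolding continuous_within using tendsto_cong[of "\<lambda>w. h (?\<phi> w)" "\<lambda>(x, t). f x t"] by simp
qed

section \<open>Bump functions\<close>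

text \<open>As a function of the coordinate distance to \<open>y0\<close> it decreases strictly up to distance \<open>R\<close>. Hence it
has a unique maximum, and its superlevel sets at levels between \<open>0\<close> and the maximum are coordinate balls
with smooth boundary, so that it also serves as the defining function of balls.\<close>

definition bump :: "('a, 'n) chart \<Rightarrow> real ^ 'n \<Rightarrow> real \<Rightarrow> 'a \<Rightarrow> real" where
  "bump c y0 R x = (if x \<in> chart_dom c then flat 0 (R\<^sup>2 - (chart_map c x - y0) \<bullet> (chart_map c x - y0)) else 0)"

lemma flat_0_mono: "s \<le> t \<Longrightarrow> flat 0 s \<le> flat 0 t"
  using flat_0_strict_mono[of t s] flat_0_nonneg[of t] by (cases "s = t"; cases "t > 0") (auto simp: flat_def)

lemma smooth_on_open_flat_ball:
  "smooth_on_open UNIV (\<lambda>y :: real ^ 'k. flat 0 (r - (y - y0) \<bullet> (y - y0)))"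
proof (rule smooth_on_open_compose[OF _ smooth_on_open_flat])
  show "smooth_on_open UNIV (\<lambda>y :: real ^ 'k. r - (y - y0) \<bullet> (y - y0))"
    by (intro smooth_on_open_diff smooth_on_open_inner smooth_on_open_const
        smooth_on_open_bounded_linear bounded_linear_ident open_UNIV)
qed auto

context
  fixes c y0 R
  assumes c: "c \<in> A" and R: "R > 0" and ball: "cball y0 R \<subseteq> chart_image c"
begin

lemma bump_nonneg: "0 \<le> bump c y0 R x"
  by (simp add: bump_def flat_0_nonneg)

lemma bump_le: "bump c y0 R x \<le> flat 0 (R\<^sup>2)"
  by (auto simp: bump_def flat_0_nonneg intro!: flat_0_mono)

lemma bump_center: "bump c y0 R (chart_inv c y0) = flat 0 (R\<^sup>2)"
proof -
  have "y0 \<in> chart_image c" using R ball by auto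
  then show ?thesis using c by (simp add: bump_def chart_map_inv chart_inv_in)
qed

lemma bump_lt:
  assumes "x \<noteq> chart_inv c y0"
  shows "bump c y0 R x < flat 0 (R\<^sup>2)"
proof (cases "x \<in> chart_dom c")
  case True
  then have "chart_map c x \<noteq> y0" using assms chart_inv_map[OF c] by metis
  then have "(chart_map c x - y0) \<bullet> (chart_map c x - y0) > 0" by simp
  then show ?thesis using True R by (simp add: bump_def flat_0_strict_mono)
next
  case False
  then show ?thesis using R by (simp add: bump_def flat_def)
qed

lemma bump_compact_support: "compact (chart_inv c ` cball y0 R)"
  using continuous_on_subset[OF continuous_on_chart_inv[OF c] ball] by (intro compact_continuous_image) auto

lemma bump_support: "x \<notin> chart_inv c ` cball y0 R \<Longrightarrow> bump c y0 R x = 0"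
proof (cases "x \<in> chart_dom c")
  case True
  assume "x \<notin> chart_inv c ` cball y0 R"
  then have "chart_map c x \<notin> cball y0 R" using True chart_inv_map[OF c] by force
  then have "dist y0 (chart_map c x) > R" by simp
  then have "R\<^sup>2 \<le> (dist y0 (chart_map c x))\<^sup>2" using R by (intro power_mono) auto
  also have "\<dots> = (chart_map c x - y0) \<bullet> (chart_map c x - y0)"
    by (simp add: dist_norm norm_minus_commute[of y0] power2_norm_eq_inner)
  finally show ?thesis using True by (simp add: bump_def flat_def)
qed (simp add: bump_def)

text \<open>In another chart the function is the composition of a smooth function with a change of coordinates
on the overlap, and it vanishes off the support. The two regions are open and cover the chart
because the support, being compact in a Hausdorff space, is closed.\<close>

lemma smooth_bump:
  assumes d: "d \<in> A"
  shows "smooth_on_open (chart_image d) (\<lambda>y. bump c y0 R (chart_inv d y))"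
proof (rule smooth_on_open_local)
  fix y assume y: "y \<in> chart_image d"
  let ?S = "{y \<in> chart_image d. chart_inv d y \<in> chart_dom c}"
  let ?T = "{y \<in> chart_image d. chart_inv d y \<in> - chart_inv c ` cball y0 R}"
  show "\<exists>W. y \<in> W \<and> W \<subseteq> chart_image d \<and> smooth_on_open W (\<lambda>y. bump c y0 R (chart_inv d y))"
  proof (cases "y \<in> ?S")
    case True
    have "smooth_on_open ?S (\<lambda>y. (\<lambda>y. flat 0 (R\<^sup>2 - (y - y0) \<bullet> (y - y0))) (transition d c y))"
      by (rule smooth_on_open_compose[OF smooth_transition_overlap[OF c d] smooth_on_open_flat_ball]) auto
    then have "smooth_on_open ?S (\<lambda>y. bump c y0 R (chart_inv d y))"
      by (rule smooth_on_open_cong) (simp add: bump_def transition_def)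
    with True show ?thesis by (intro exI[of _ ?S]) auto
  next
    case False
    have "chart_inv c ` cball y0 R \<subseteq> chart_dom c" using ball c chart_inv_in by blast
    then have "y \<in> ?T" using False y by auto
    have "open (- chart_inv c ` cball y0 R)"
      using bump_compact_support compact_imp_closed by (auto simp: open_Compl)
    then have "open ?T" by (rule open_chart_inv_vimage[OF d])
    then have "smooth_on_open ?T (\<lambda>y. bump c y0 R (chart_inv d y))"
      by (intro smooth_on_open_cong[OF smooth_on_open_const[of _ 0]]) (auto simp: bump_support)
    with \<open>y \<in> ?T\<close> show ?thesis by (intro exI[of _ ?T]) auto
  qed
qed

end

end

context riemannian_manifold
begin

section \<open>Gradient, normal and mean curvature in coordinates\<close>

lemma metric_invertible:
  assumes "c \<in> A" "p \<in> chart_dom c"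
  shows "invertible (g c p)"
proof -
  have "v = 0" if "g c p *v v = 0" for v
    using metric_pos[OF assms, of v] that by force
  then show ?thesis
    by (simp add: invertible_left_inverse matrix_left_invertible_ker)
qed

lemma matrix_inv_metric:
  assumes "c \<in> A" "p \<in> chart_dom c"
  shows "g c p *v (matrix_inv (g c p) *v q) = q"
proof -
  have "g c p ** matrix_inv (g c p) = mat 1"
    using metric_invertible[OF assms] unfolding invertible_def matrix_inv_def
    by (rule someI2_ex) simp
  then show ?thesis by (simp add: matrix_vector_mul_assoc)
qed

lemma gradient_eq_0_iff:
  assumes "c \<in> A" "p \<in> chart_dom c"
  shows "gradient g c u p = 0 \<longleftrightarrow> (\<forall>i. pd c i u p = 0)"
proof
  assume "gradient g c u p = 0"
  then have "(\<chi> i. pd c i u p) = 0"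
    using matrix_inv_metric[OF assms, of "\<chi> i. pd c i u p"] by (simp add: gradient_def)
  then show "\<forall>i. pd c i u p = 0" by (simp add: vec_eq_iff)
next
  assume "\<forall>i. pd c i u p = 0"
  then have "(\<chi> i. pd c i u p) = 0" by (simp add: vec_eq_iff)
  then show "gradient g c u p = 0" by (simp add: gradient_def)
qed

lemma gradient_eq_0_iff_critical:
  assumes "c \<in> A" "p \<in> chart_dom c"
    and D: "((u \<circ> chart_inv c) has_derivative D) (at (chart_map c p))"
  shows "gradient g c u p = 0 \<longleftrightarrow> D = (\<lambda>v. 0)"
proof -
  interpret linear D using D by (rule has_derivative_linear)
  have pd: "pd c i u p = D (axis i 1)" for i
    using frechet_derivative_at[OF D] by (simp add: pd_def)
  have "D = (\<lambda>v. 0)" if "\<forall>i. D (axis i 1) = 0"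
  proof
    fix v
    have "D (\<Sum>b\<in>Basis. (v \<bullet> b) *\<^sub>R b) = (\<Sum>b\<in>Basis. (v \<bullet> b) *\<^sub>R D b)"
      by (simp only: sum scaleR)
    also have "\<dots> = 0" using that by (intro sum.neutral) (auto simp: Basis_vec_def)
    finally show "D v = 0" by (simp add: euclidean_representation)
  qed
  then show ?thesis
    unfolding gradient_eq_0_iff[OF assms(1,2)] pd by auto
qed

lemma gradient_eq_0_chart_independent:
  assumes "c \<in> A" "d \<in> A" "p \<in> chart_dom c" "p \<in> chart_dom d"
    and D: "((u \<circ> chart_inv c) has_derivative D) (at (chart_map c p))"
    and 0: "gradient g c u p = 0"
  shows "gradient g d u p = 0"
proof -
  have "D = (\<lambda>v. 0)" using 0 gradient_eq_0_iff_critical[OF assms(1,3) D] by simp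
  from critical_chart_independent[OF assms(1-4) D[unfolded this]]
  show ?thesis using gradient_eq_0_iff_critical[OF assms(2,4)] by blast
qed

text \<open>The vector that corresponds to the covector \<open>q\<close> under the metric; the gradient is obtained from the
differential in this way.\<close>

definition sharp :: "('a, 'n) chart \<Rightarrow> real ^ 'n \<Rightarrow> real ^ 'n \<Rightarrow> real ^ 'n" where
  "sharp c y q = matrix_inv (g c (chart_inv c y)) *v q"

lemma smooth_metric_entry:
  "c \<in> A \<Longrightarrow> smooth_on_open (chart_image c) (\<lambda>y. g c (chart_inv c y) $ i $ j)"
  by (intro smooth_on_open_vec_nth metric_smooth)

text \<open>Cramer's rule expresses the inverse of the Gram matrix by determinants, which are polynomials in its
smooth entries.\<close>

lemma smooth_sharp:
  assumes c: "c \<in> A" and S: "smooth_on_open S \<phi>" "\<phi> ` S \<subseteq> chart_image c" and q: "smooth_on_open S q"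
  shows "smooth_on_open S (\<lambda>w. sharp c (\<phi> w) (q w))"
proof -
  let ?G = "\<lambda>w. g c (chart_inv c (\<phi> w))"
  have oS: "open S" using q by (rule smooth_on_open_imp_open)
  have G: "smooth_on_open S (\<lambda>w. ?G w $ i $ j)" for i j
    by (rule smooth_on_open_compose[OF S(1) smooth_metric_entry[OF c] S(2)])
  have det: "det (?G w) \<noteq> 0" if "w \<in> S" for w
    using metric_invertible[OF c chart_inv_in[OF c]] S(2) that by (auto simp: invertible_det_nz)
  have entry: "smooth_on_open S (\<lambda>w. (\<chi> i j. if j = k then q w $ i else ?G w $ i $ j) $ i $ j)" for k i j
    by (cases "j = k") (simp_all add: G smooth_on_open_vec_nth[OF q])
  have "smooth_on_open S (\<lambda>w. \<chi> k. det (\<chi> i j. if j = k then q w $ i else ?G w $ i $ j) / det (?G w))"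
    by (intro smooth_on_open_vec_lambda smooth_on_open_divide smooth_on_open_det oS entry G det)
  then show ?thesis
  proof (rule smooth_on_open_cong)
    fix w assume w: "w \<in> S"
    have "?G w *v sharp c (\<phi> w) (q w) = q w"
      using matrix_inv_metric[OF c chart_inv_in[OF c]] w S(2) by (auto simp: sharp_def)
    then show "(\<chi> k. det (\<chi> i j. if j = k then q w $ i else ?G w $ i $ j) / det (?G w)) = sharp c (\<phi> w) (q w)"
      using cramer[OF det[OF w], of "sharp c (\<phi> w) (q w)" "q w"] by simp
  qed
qed

text \<open>The squared length of the covector \<open>q\<close> in the dual metric.\<close>

definition conorm2 :: "('a, 'n) chart \<Rightarrow> real ^ 'n \<Rightarrow> real ^ 'n \<Rightarrow> real" where
  "conorm2 c y q = sharp c y q \<bullet> (g c (chart_inv c y) *v sharp c y q)"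

lemma smooth_conorm2:
  assumes c: "c \<in> A" and S: "smooth_on_open S \<phi>" "\<phi> ` S \<subseteq> chart_image c" and q: "smooth_on_open S q"
  shows "smooth_on_open S (\<lambda>w. conorm2 c (\<phi> w) (q w))"
proof -
  have oS: "open S" using q by (rule smooth_on_open_imp_open)
  have "smooth_on_open S (\<lambda>w. sharp c (\<phi> w) (q w) \<bullet>
      (\<chi> i. \<Sum>j\<in>UNIV. g c (chart_inv c (\<phi> w)) $ i $ j * sharp c (\<phi> w) (q w) $ j))"
    by (intro smooth_on_open_inner smooth_on_open_vec_lambda smooth_on_open_sum smooth_on_open_mult
        smooth_on_open_vec_nth smooth_sharp smooth_on_open_compose[OF S(1) smooth_metric_entry[OF c] S(2)] oS assms)
  then show ?thesis by (simp add: conorm2_def matrix_vector_mult_def)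
qed

lemma conorm2_pos:
  assumes "c \<in> A" "y \<in> chart_image c" "q \<noteq> 0"
  shows "conorm2 c y q > 0"
proof -
  have "g c (chart_inv c y) *v sharp c y q = q"
    using matrix_inv_metric[OF assms(1) chart_inv_in] assms by (simp add: sharp_def)
  then have "sharp c y q \<noteq> 0" using assms(3) by auto
  then show ?thesis
    using metric_pos[OF assms(1) chart_inv_in] assms by (simp add: conorm2_def)
qed

lemma smooth_christoffel:
  assumes c: "c \<in> A"
  shows "smooth_on_open (chart_image c) (\<lambda>y. christoffel g c k i j (chart_inv c y))"
proof -
  have pd: "smooth_on_open (chart_image c) (\<lambda>y. pd c i (\<lambda>q. g c q $ j $ l) (chart_inv c y))" for i j l
    by (rule smooth_on_open_cong[OF smooth_on_open_frechet_derivative[OF smooth_metric_entry[OF c]]])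
      (simp add: pd_def chart_map_inv[OF c] comp_def)
  have inv: "smooth_on_open (chart_image c) (\<lambda>y. matrix_inv (g c (chart_inv c y)) $ k $ l)" for l
  proof (rule smooth_on_open_cong)
    show "smooth_on_open (chart_image c) (\<lambda>y. sharp c y (axis l 1) $ k)"
      using open_chart_image[OF c]
      by (intro smooth_on_open_vec_nth smooth_sharp[OF c] smooth_on_open_const
          smooth_on_open_bounded_linear bounded_linear_ident) auto
    show "sharp c y (axis l 1) $ k = matrix_inv (g c (chart_inv c y)) $ k $ l" for y
      by (simp add: sharp_def matrix_vector_mult_basis column_def)
  qed
  show ?thesis
    unfolding christoffel_def
    by (intro smooth_on_open_divide smooth_on_open_sum smooth_on_open_mult smooth_on_open_diff
        smooth_on_open_add smooth_on_open_const pd inv open_chart_image[OF c]) simp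
qed

text \<open>In coordinates the unit normal of the level sets of \<open>H\<close> is a smooth function of the point and of the
parameter \<open>s\<close>, as long as the spatial differential of \<open>H\<close> does not vanish, and the mean curvature is
built from its first derivatives. The parameter stands for the time and for the sizes of
perturbations: joint continuity of \<open>E\<close> and \<open>L\<close> is what preserves the sign of \<^const>\<open>Phi\<close> when a
barrier is perturbed.\<close>

lemma mean_curvature_coordinates:
  fixes H :: "(real ^ 'n) \<times> 'p::real_normed_vector \<Rightarrow> real"
  assumes c: "c \<in> A" and W: "smooth_on_open W H" "W \<subseteq> chart_image c \<times> UNIV"
    and nz: "\<And>w. w \<in> W \<Longrightarrow> \<exists>v. frechet_derivative H (at w) (v, 0) \<noteq> 0"
  obtains E L where "continuous_on W E" "continuous_on W L" "\<And>w. w \<in> W \<Longrightarrow> L w > 0"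
    "\<And>f t y s. (y, s) \<in> W \<Longrightarrow>
      (\<And>y'. (y', s) \<in> W \<Longrightarrow> f (chart_inv c y') t = H (y', s)) \<Longrightarrow>
      mean_curv g c f (chart_inv c y) t = E (y, s) \<and>
      vlength g c (chart_inv c y) (gradient g c (\<lambda>x. f x t) (chart_inv c y)) = L (y, s)"
proof -
  have oW: "open W" using W by (auto dest: smooth_on_open_imp_open)
  define q where "q w = (\<chi> i. frechet_derivative H (at w) (axis i 1, 0))" for w
  have q: "smooth_on_open W q"
    unfolding q_def by (intro smooth_on_open_vec_lambda smooth_on_open_frechet_derivative W oW)
  have fst: "smooth_on_open W (fst :: (real ^ 'n) \<times> 'p \<Rightarrow> _)" "fst ` W \<subseteq> chart_image c"
    using W(2) by (auto intro: smooth_on_open_bounded_linear bounded_linear_fst oW)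
  have q_nz: "q w \<noteq> 0" if w: "w \<in> W" for w
  proof
    assume "q w = 0"
    then have 0: "frechet_derivative H (at w) (axis i 1, 0) = 0" for i
      by (simp add: q_def vec_eq_iff)
    obtain y s where w': "w = (y, s)" by force
    let ?D = "\<lambda>v. frechet_derivative H (at w) (v, 0)"
    have "linear ?D"
      using has_derivative_linear[OF smooth_slice_has_derivative[OF W(1)]] w w' by blast
    then interpret D: linear ?D .
    have "?D v = 0" for v
    proof -
      have "?D (\<Sum>b\<in>Basis. (v \<bullet> b) *\<^sub>R b) = (\<Sum>b\<in>Basis. (v \<bullet> b) *\<^sub>R ?D b)"
        by (simp only: D.sum D.scaleR)
      also have "\<dots> = 0" using 0 by (intro sum.neutral) (auto simp: Basis_vec_def)
      finally show "?D v = 0" by (simp add: euclidean_representation)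
    qed
    with nz[OF w] show False by blast
  qed
  define L where "L w = sqrt (conorm2 c (fst w) (q w))" for w
  define N where "N w = sharp c (fst w) (q w) /\<^sub>R L w" for w
  have pos: "conorm2 c (fst w) (q w) > 0" if "w \<in> W" for w
    using conorm2_pos[OF c _ q_nz[OF that]] that W(2) by auto
  have L: "smooth_on_open W L"
    unfolding L_def by (intro smooth_on_open_sqrt smooth_conorm2 c fst q pos)
  have Lpos: "L w > 0" if "w \<in> W" for w
    using pos[OF that] by (simp add: L_def)
  have "smooth_on_open W (\<lambda>w. (1 / L w) *\<^sub>R sharp c (fst w) (q w))"
    by (intro smooth_on_open_scaleR smooth_on_open_divide smooth_on_open_const smooth_sharp c fst q L oW)
      (use Lpos in force)
  then have N: "smooth_on_open W N"
    by (rule smooth_on_open_cong) (simp add: N_def inverse_eq_divide)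
  define E where "E w = - (\<Sum>i\<in>UNIV. frechet_derivative (\<lambda>w. N w $ i) (at w) (axis i 1, 0) +
      (\<Sum>j\<in>UNIV. christoffel g c i i j (chart_inv c (fst w)) * N w $ j))" for w
  have "smooth_on_open W E"
    unfolding E_def
    by (intro smooth_on_open_linear_compose[OF bounded_linear_minus[OF bounded_linear_ident]]
        smooth_on_open_sum smooth_on_open_add smooth_on_open_mult
        smooth_on_open_frechet_derivative smooth_on_open_vec_nth N oW
        smooth_on_open_compose[OF fst(1) smooth_christoffel[OF c] fst(2)])
  moreover have "mean_curv g c f (chart_inv c y) t = E (y, s)"
      "vlength g c (chart_inv c y) (gradient g c (\<lambda>x. f x t) (chart_inv c y)) = L (y, s)"
    if ys: "(y, s) \<in> W" and f: "\<And>y'. (y', s) \<in> W \<Longrightarrow> f (chart_inv c y') t = H (y', s)" for f t y s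
  proof -
    have ch: "y' \<in> chart_image c" if "(y', s) \<in> W" for y' using that W(2) by auto
    have oWs: "open {y'. (y', s) \<in> W}" using oW by (rule open_slice)
    have pd: "pd c i (\<lambda>x. f x t) (chart_inv c y') = q (y', s) $ i" if y': "(y', s) \<in> W" for y' i
    proof -
      have "(((\<lambda>x. f x t) \<circ> chart_inv c) has_derivative (\<lambda>v. frechet_derivative H (at (y', s)) (v, 0))) (at y')"
        by (rule has_derivative_transform_within_open[OF smooth_slice_has_derivative[OF W(1) y'] oWs])
          (use y' f in auto)
      from frechet_derivative_at[OF this, symmetric] show ?thesis
        by (simp add: pd_def q_def chart_map_inv[OF c ch[OF y']])
    qed
    have grad: "gradient g c (\<lambda>x. f x t) (chart_inv c y') = sharp c y' (q (y', s))" if "(y', s) \<in> W" for y'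
      using pd[OF that] by (simp add: gradient_def sharp_def)
    have len: "vlength g c (chart_inv c y') (gradient g c (\<lambda>x. f x t) (chart_inv c y')) = L (y', s)"
      if "(y', s) \<in> W" for y'
      using grad[OF that] by (simp add: vlength_def L_def conorm2_def)
    show "vlength g c (chart_inv c y) (gradient g c (\<lambda>x. f x t) (chart_inv c y)) = L (y, s)"
      using len[OF ys] .
    have normal: "unit_normal g c f t (chart_inv c y') = N (y', s)" if "(y', s) \<in> W" for y'
      using len[OF that] grad[OF that] by (simp add: unit_normal_def N_def)
    have "frechet_derivative ((\<lambda>x. unit_normal g c f t x $ i) \<circ> chart_inv c) (at y) (axis i 1)
        = frechet_derivative (\<lambda>w. N w $ i) (at (y, s)) (axis i 1, 0)" for i
    proof -
      have "((\<lambda>y'. N (y', s) $ i) has_derivative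
          (\<lambda>v. frechet_derivative (\<lambda>w. N w $ i) (at (y, s)) (v, 0))) (at y)"
        by (rule smooth_slice_has_derivative[OF smooth_on_open_vec_nth[OF N] ys])
      then have "(((\<lambda>x. unit_normal g c f t x $ i) \<circ> chart_inv c) has_derivative
          (\<lambda>v. frechet_derivative (\<lambda>w. N w $ i) (at (y, s)) (v, 0))) (at y)"
        by (rule has_derivative_transform_within_open[OF _ oWs])
          (use ys normal in auto)
      from frechet_derivative_at[OF this, symmetric] show ?thesis by simp
    qed
    then show "mean_curv g c f (chart_inv c y) t = E (y, s)"
      using normal[OF ys] chart_map_inv[OF c ch[OF ys]]
      by (simp add: mean_curv_def divergence_def cov_deriv_def pd_def E_def)
  qed
  ultimately show ?thesis
    using that[of E L] L Lpos smooth_on_open_imp_continuous_on by blast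
qed

section \<open>Compact barriers\<close>

lemma compact_spacetime_sublevel:
  assumes f: "smooth_spacetime A a b f" and L: "compact L"
    and sub: "\<And>x t. t \<in> {a..b} \<Longrightarrow> f x t \<le> 0 \<Longrightarrow> x \<in> L"
  shows "compact {(x, t). t \<in> {a..b} \<and> f x t \<le> 0}"
proof -
  let ?S = "(UNIV \<times> {a..b}) \<inter> (\<lambda>(x, t). f x t) -` {..0}"
  have "closed ?S"
    by (rule continuous_closed_preimage[OF smooth_spacetime_continuous_on[OF f]])
      (auto intro: closed_Times)
  then have "compact ((L \<times> {a..b}) \<inter> ?S)"
    by (intro compact_Int_closed compact_Times L) auto
  moreover have "(L \<times> {a..b}) \<inter> ?S = {(x, t). t \<in> {a..b} \<and> f x t \<le> 0}"
    using sub by auto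
  ultimately show ?thesis by simp
qed

lemma compact_family_sublevel:
  assumes f: "smooth_spacetime A a b f" and L: "compact L"
    and sub: "\<And>x t. t \<in> {a..b} \<Longrightarrow> f x t \<le> 0 \<Longrightarrow> x \<in> L"
    and K: "\<And>t. t \<in> {a..b} \<Longrightarrow> K t = {x. f x t \<le> 0}"
  shows "compact_family a b K"
proof -
  have "(\<Union>t\<in>{a..b}. K t) = fst ` {(x, t). t \<in> {a..b} \<and> f x t \<le> 0}"
    using K by force
  then show ?thesis
    using compact_continuous_image[OF continuous_on_fst[OF continuous_on_id] compact_spacetime_sublevel[OF f L sub]]
    by (simp add: compact_family_def)
qed

lemma barrier_via_subinterval:
  assumes "barrier_via A g a b K f" "{a'..b'} \<subseteq> {a..b}"
  shows "barrier_via A g a' b' K f"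
  using assms smooth_spacetime_subinterval[of a b f a' b'] unfolding barrier_via_def by blast

lemma compact_family_subinterval:
  assumes "barrier_via A g a b K f" "compact_family a b K" "{a'..b'} \<subseteq> {a..b}"
  shows "compact_family a' b' K"
proof (rule compact_family_sublevel)
  show "smooth_spacetime A a' b' f" "\<And>t. t \<in> {a'..b'} \<Longrightarrow> K t = {x. f x t \<le> 0}"
    using barrier_via_subinterval[OF assms(1,3)] by (auto simp: barrier_via_def)
  show "compact (\<Union>t\<in>{a..b}. K t)" using assms(2) by (simp add: compact_family_def)
  show "x \<in> (\<Union>t\<in>{a..b}. K t)" if "t \<in> {a'..b'}" "f x t \<le> 0" for x t
    using that assms(1,3) by (auto simp: barrier_via_def)
qed

lemma local_rep_perturb:
  assumes "local_rep c a b f W h" "local_rep c a b w W' h'"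
  shows "local_rep c a b (\<lambda>x t. f x t + l * w x t) (W \<inter> W') (\<lambda>z. h z + l * h' z)"
proof -
  have W: "smooth_on_open W h" "smooth_on_open W' h'" using assms by (auto simp: local_rep_def)
  have o: "open (W \<inter> W')" using W by (auto dest: smooth_on_open_imp_open)
  have "smooth_on_open (W \<inter> W') (\<lambda>z. h z + l * h' z)"
    using W by (intro smooth_on_open_add smooth_on_open_mult smooth_on_open_const o
        smooth_on_open_subset[OF W(1) o] smooth_on_open_subset[OF W(2) o]) auto
  then show ?thesis using assms by (auto simp: local_rep_def)
qed

lemma local_rep_perturb_derivative:
  assumes "local_rep c a b f W h" "local_rep c a b w W' h'" "z \<in> W \<inter> W'"
  shows "frechet_derivative (\<lambda>z. h z + l * h' z) (at z) v =
    frechet_derivative h (at z) v + l * frechet_derivative h' (at z) v"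
proof -
  have "(h has_derivative frechet_derivative h (at z)) (at z)"
    "(h' has_derivative frechet_derivative h' (at z)) (at z)"
    using assms by (auto simp: local_rep_def intro: smooth_on_open_has_derivative)
  then have "((\<lambda>z. h z + l * h' z) has_derivative
      (\<lambda>v. frechet_derivative h (at z) v + l * frechet_derivative h' (at z) v)) (at z)"
    by (auto intro!: derivative_eq_intros)
  from frechet_derivative_at[OF this, symmetric] show ?thesis by simp
qed

text \<open>Second countability makes compact sets sequentially compact.\<close>

lemma spacetime_seq_limit:
  fixes L :: "'a set" and a b :: real
  assumes "compact L" "\<And>n. x n \<in> L" "\<And>n::nat. s n \<in> {a..b}"
  obtains r x0 s0 where "strict_mono (r :: nat \<Rightarrow> nat)" "x0 \<in> L" "s0 \<in> {a..b}"
    "(\<lambda>n. x (r n)) \<longlonglongrightarrow> x0" "(\<lambda>n. s (r n)) \<longlonglongrightarrow> s0"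
proof -
  have "seq_compact (L \<times> {a..b})"
    using assms(1) by (intro compact_imp_seq_compact compact_Times) auto
  moreover have "\<forall>n. (x n, s n) \<in> L \<times> {a..b}" using assms(2,3) by simp
  ultimately obtain z r
    where z: "z \<in> L \<times> {a..b}" "strict_mono (r :: nat \<Rightarrow> nat)" "((\<lambda>n. (x n, s n)) \<circ> r) \<longlonglongrightarrow> z"
    by (rule seq_compactE)
  then have "(\<lambda>n. x (r n)) \<longlonglongrightarrow> fst z" "(\<lambda>n. s (r n)) \<longlonglongrightarrow> snd z"
    using tendsto_fst[OF z(3)] tendsto_snd[OF z(3)] by (auto simp: comp_def)
  then show ?thesis using that z by auto
qed

lemma spacetime_tendsto:
  assumes "smooth_spacetime A a b f" "x \<longlonglongrightarrow> x0" "s \<longlonglongrightarrow> s0" "\<And>n::nat. s n \<in> {a..b}" "s0 \<in> {a..b}"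
  shows "(\<lambda>n. f (x n) (s n)) \<longlonglongrightarrow> f x0 s0"
proof -
  have "(\<lambda>n. (x n, s n)) \<longlonglongrightarrow> (x0, s0)" using assms by (intro tendsto_Pair)
  from continuous_on_tendsto_compose[OF smooth_spacetime_continuous_on[OF assms(1)] this]
  show ?thesis using assms by auto
qed

lemma chart_seq:
  assumes "c \<in> A" "x0 \<in> chart_dom c" "x \<longlonglongrightarrow> x0"
  shows "eventually (\<lambda>n. x n \<in> chart_dom c) sequentially"
    "(\<lambda>n. chart_map c (x n)) \<longlonglongrightarrow> chart_map c x0"
proof -
  show ev: "eventually (\<lambda>n. x n \<in> chart_dom c) sequentially"
    using topological_tendstoD[OF assms(3) open_chart_dom[OF assms(1)] assms(2)] .
  show "(\<lambda>n. chart_map c (x n)) \<longlonglongrightarrow> chart_map c x0"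
    by (rule continuous_on_tendsto_compose[OF continuous_on_chart_map[OF assms(1)] assms(3,2) ev])
qed

text \<open>Outside \<open>L\<close> the perturbation can only shrink the region, so all perturbed regions stay in one compact
set. If degenerate zeros occurred for arbitrarily small \<open>l\<close>, then they would accumulate at a
degenerate zero of \<open>f\<close> itself.\<close>

lemma barrier_perturbation:
  assumes K: "barrier_via A g a b K f" "compact_family a b K"
    and w: "smooth_spacetime A a b w" "compact L" "\<And>x t. t \<in> {a..b} \<Longrightarrow> x \<notin> L \<Longrightarrow> w x t \<ge> 0"
  shows "eventually (\<lambda>l. barrier_via A g a b (\<lambda>t. {x. f x t + l * w x t \<le> 0}) (\<lambda>x t. f x t + l * w x t) \<and>
    compact_family a b (\<lambda>t. {x. f x t + l * w x t \<le> 0})) (at_right 0)"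
proof -
  let ?F = "\<lambda>l x t. f x t + l * w x t"
  let ?L = "(\<Union>t\<in>{a..b}. K t) \<union> L"
  have f: "smooth_spacetime A a b f" using K by (simp add: barrier_via_def)
  have F: "smooth_spacetime A a b (?F l)" for l
    using f w by (intro smooth_spacetime_add smooth_spacetime_cmult)
  have cL: "compact ?L" using K w by (auto simp: compact_family_def)
  have sub: "x \<in> ?L" if "t \<in> {a..b}" "?F l x t \<le> 0" "l > 0" for x t l
  proof (rule ccontr)
    assume x: "x \<notin> ?L"
    then have "f x t > 0" using K that by (force simp: barrier_via_def)
    moreover have "w x t \<ge> 0" using w(3) that x by auto
    then have "l * w x t \<ge> 0" using that by simp
    ultimately show False using that(2) by linarith
  qed
  have cF: "compact_family a b (\<lambda>t. {x. ?F l x t \<le> 0})" if "l > 0" for l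
    by (rule compact_family_sublevel[OF F cL sub]) (use that in auto)
  define reg where "reg l \<longleftrightarrow> (\<forall>t\<in>{a..b}. \<forall>x. ?F l x t = 0 \<longrightarrow>
    (\<forall>c\<in>A. x \<in> chart_dom c \<longrightarrow> gradient g c (\<lambda>q. ?F l q t) x \<noteq> 0))" for l
  have "\<exists>l0>0. \<forall>l. 0 < l \<longrightarrow> l < l0 \<longrightarrow> reg l"
  proof (rule ccontr)
    assume neg: "\<not> ?thesis"
    have "\<exists>l. 0 < l \<and> l < inverse (real (Suc n)) \<and> \<not> reg l" for n
      using neg by (metis inverse_positive_iff_positive of_nat_0_less_iff zero_less_Suc)
    then obtain l where l: "\<And>n. 0 < l n" "\<And>n. l n < inverse (real (Suc n))" "\<And>n. \<not> reg (l n)"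
      by metis
    from l(3) have "\<forall>n. \<exists>s x c. s \<in> {a..b} \<and> ?F (l n) x s = 0 \<and> c \<in> A \<and> x \<in> chart_dom c \<and>
        gradient g c (\<lambda>q. ?F (l n) q s) x = 0"
      unfolding reg_def by blast
    then obtain s where "\<forall>n. \<exists>x c. s n \<in> {a..b} \<and> ?F (l n) x (s n) = 0 \<and> c \<in> A \<and> x \<in> chart_dom c \<and>
        gradient g c (\<lambda>q. ?F (l n) q (s n)) x = 0"
      using choice[of "\<lambda>n s. \<exists>x c. s \<in> {a..b} \<and> ?F (l n) x s = 0 \<and> c \<in> A \<and> x \<in> chart_dom c \<and>
        gradient g c (\<lambda>q. ?F (l n) q s) x = 0"] by blast
    then obtain x where "\<forall>n. \<exists>c. s n \<in> {a..b} \<and> ?F (l n) (x n) (s n) = 0 \<and> c \<in> A \<and> x n \<in> chart_dom c \<and>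
        gradient g c (\<lambda>q. ?F (l n) q (s n)) (x n) = 0"
      using choice[of "\<lambda>n x. \<exists>c. s n \<in> {a..b} \<and> ?F (l n) x (s n) = 0 \<and> c \<in> A \<and> x \<in> chart_dom c \<and>
        gradient g c (\<lambda>q. ?F (l n) q (s n)) x = 0"] by blast
    then obtain c where "\<forall>n. s n \<in> {a..b} \<and> ?F (l n) (x n) (s n) = 0 \<and> c n \<in> A \<and> x n \<in> chart_dom (c n) \<and>
        gradient g (c n) (\<lambda>q. ?F (l n) q (s n)) (x n) = 0"
      using choice[of "\<lambda>n c. s n \<in> {a..b} \<and> ?F (l n) (x n) (s n) = 0 \<and> c \<in> A \<and> x n \<in> chart_dom c \<and>
        gradient g c (\<lambda>q. ?F (l n) q (s n)) (x n) = 0"] by blast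
    then have sx: "\<And>n. s n \<in> {a..b}" "\<And>n. ?F (l n) (x n) (s n) = 0" "\<And>n. c n \<in> A"
      "\<And>n. x n \<in> chart_dom (c n)" "\<And>n. gradient g (c n) (\<lambda>q. ?F (l n) q (s n)) (x n) = 0"
      by blast+
    have "x n \<in> ?L" for n using sub[OF sx(1)[of n], of "x n" "l n"] sx(2)[of n] l(1)[of n] by simp
    then obtain r x0 s0 where r: "strict_mono (r :: nat \<Rightarrow> nat)" "x0 \<in> ?L" "s0 \<in> {a..b}"
      "(\<lambda>n. x (r n)) \<longlonglongrightarrow> x0" "(\<lambda>n. s (r n)) \<longlonglongrightarrow> s0"
      by (rule spacetime_seq_limit[OF cL _ sx(1)])
    have "l \<longlonglongrightarrow> 0"
      by (rule real_tendsto_sandwich[OF _ _ tendsto_const LIMSEQ_inverse_real_of_nat])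
        (use l in \<open>auto intro!: always_eventually less_imp_le\<close>)
    then have lr: "(\<lambda>n. l (r n)) \<longlonglongrightarrow> 0"
      using LIMSEQ_subseq_LIMSEQ[OF _ r(1)] by (simp add: comp_def)
    have "(\<lambda>n. ?F (l (r n)) (x (r n)) (s (r n))) \<longlonglongrightarrow> ?F 0 x0 s0"
      by (rule tendsto_add[OF spacetime_tendsto[OF f r(4,5) sx(1) r(3)]
            tendsto_mult[OF lr spacetime_tendsto[OF w(1) r(4,5) sx(1) r(3)]]])
    then have f0: "f x0 s0 = 0" using sx(2) by (simp add: LIMSEQ_const_iff)
    obtain d where d: "d \<in> A" "x0 \<in> chart_dom d" by (rule chart_at)
    obtain W h where W: "(chart_map d x0, s0) \<in> W" "local_rep d a b f W h"
      using smooth_spacetime_local_rep[OF f d r(3)] .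
    obtain W' h' where W': "(chart_map d x0, s0) \<in> W'" "local_rep d a b w W' h'"
      using smooth_spacetime_local_rep[OF w(1) d r(3)] .
    let ?y = "\<lambda>n. (chart_map d (x (r n)), s (r n))"
    have y: "?y \<longlonglongrightarrow> (chart_map d x0, s0)"
      by (intro tendsto_Pair chart_seq[OF d r(4)] r)
    have sm: "smooth_on_open W h" "smooth_on_open W' h'"
      using W W' by (auto simp: local_rep_def)
    have ev: "eventually (\<lambda>n. ?y n \<in> W \<inter> W' \<and> x (r n) \<in> chart_dom d) sequentially"
      using W(1) W'(1) sm
      by (auto intro!: eventually_conj topological_tendstoD[OF y] chart_seq(1)[OF d r(4)] open_Int
          dest: smooth_on_open_imp_open simp del: Int_iff)
    have zero: "frechet_derivative h (at (chart_map d x0, s0)) (v, 0) = 0" for v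
    proof -
      let ?D = "\<lambda>z. frechet_derivative h (at z) (v, 0)" and ?D' = "\<lambda>z. frechet_derivative h' (at z) (v, 0)"
      have "eventually (\<lambda>n. ?D (?y n) + l (r n) * ?D' (?y n) = 0) sequentially"
        using ev
      proof eventually_elim
        case (elim n)
        let ?u = "\<lambda>q. ?F (l (r n)) q (s (r n))"
        let ?H = "\<lambda>z. h z + l (r n) * h' z"
        have der: "((?u \<circ> chart_inv d) has_derivative (\<lambda>v. frechet_derivative ?H (at (?y n)) (v, 0)))
            (at (chart_map d (x (r n))))"
          by (rule local_rep_has_derivative[OF local_rep_perturb[OF W(2) W'(2)] sx(1)]) (use elim in auto)
        obtain E where "((?u \<circ> chart_inv (c (r n))) has_derivative E) (at (chart_map (c (r n)) (x (r n))))"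
          by (rule smooth_spacetime_has_derivative[OF F sx(3) sx(4) sx(1)])
        then have "gradient g d ?u (x (r n)) = 0"
          using gradient_eq_0_chart_independent[OF sx(3) d(1) sx(4) _ _ sx(5)] elim by blast
        then have "frechet_derivative ?H (at (?y n)) (v, 0) = 0"
          using gradient_eq_0_iff_critical[OF d(1) _ der] elim by meson
        then show ?case using local_rep_perturb_derivative[OF W(2) W'(2)] elim by auto
      qed
      moreover have "(\<lambda>n. ?D (?y n) + l (r n) * ?D' (?y n)) \<longlonglongrightarrow>
          ?D (chart_map d x0, s0) + 0 * ?D' (chart_map d x0, s0)"
      proof (rule tendsto_add[OF _ tendsto_mult[OF lr]])
        have evW: "eventually (\<lambda>n. ?y n \<in> W) sequentially" "eventually (\<lambda>n. ?y n \<in> W') sequentially"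
          using ev by (auto elim: eventually_mono)
        show "(\<lambda>n. ?D (?y n)) \<longlonglongrightarrow> ?D (chart_map d x0, s0)"
          by (rule continuous_on_tendsto_compose[OF smooth_on_open_imp_continuous_on[OF
                  smooth_on_open_frechet_derivative[OF sm(1)]] y W(1) evW(1)])
        show "(\<lambda>n. ?D' (?y n)) \<longlonglongrightarrow> ?D' (chart_map d x0, s0)"
          by (rule continuous_on_tendsto_compose[OF smooth_on_open_imp_continuous_on[OF
                  smooth_on_open_frechet_derivative[OF sm(2)]] y W'(1) evW(2)])
      qed
      ultimately have "(\<lambda>n::nat. 0) \<longlonglongrightarrow> ?D (chart_map d x0, s0) + 0 * ?D' (chart_map d x0, s0)"
        by (rule Lim_transform_eventually[rotated])
      then show ?thesis by (simp add: LIMSEQ_const_iff)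
    qed
    have "gradient g d (\<lambda>q. f q s0) x0 = 0"
      using gradient_eq_0_iff_critical[OF d local_rep_has_derivative[OF W(2) r(3) W(1)]] zero by blast
    then show False using K(1) f0 r(3) d by (auto simp: barrier_via_def)
  qed
  then have "eventually reg (at_right 0)"
    by (auto simp: eventually_at_right)
  moreover have "eventually (\<lambda>l. l > 0) (at_right (0::real))"
    by (simp add: eventually_at_right_less)
  ultimately show ?thesis
    by eventually_elim (use F cF in \<open>auto simp: barrier_via_def reg_def\<close>)
qed

section \<open>First contact\<close>

lemma local_rep_vector_derivative:
  assumes "local_rep c a b f W h" "(y, t) \<in> W" "t \<in> {a'..b'}" "a' < b'" "{a'..b'} \<subseteq> {a..b}"
  shows "vector_derivative (f (chart_inv c y)) (at t within {a'..b'}) = frechet_derivative h (at (y, t)) (0, 1)"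
  using vector_derivative_within_closed_interval[OF assms(4,3) local_rep_has_vector_derivative[OF assms(1,3,5,2)]] .

lemma Phi_subinterval:
  assumes f: "smooth_spacetime A a b f" and c: "c \<in> A" "x \<in> chart_dom c"
    and t: "t \<in> {a'..b'}" "a' < b'" "{a'..b'} \<subseteq> {a..b}"
  shows "Phi g c a' b' f x t = Phi g c a b f x t"
proof -
  have "t \<in> {a..b}" "a < b" using t by auto
  then obtain W h where W: "(chart_map c x, t) \<in> W" "local_rep c a b f W h"
    using smooth_spacetime_local_rep[OF f c] by blast
  have "vector_derivative (f x) (at t within {a'..b'}) = vector_derivative (f x) (at t within {a..b})"
    using local_rep_vector_derivative[OF W(2,1) t] local_rep_vector_derivative[OF W(2,1) \<open>t \<in> {a..b}\<close> \<open>a < b\<close>]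
    by (simp add: chart_inv_map[OF c])
  then show ?thesis by (simp add: Phi_def normal_velocity_def)
qed

lemma smooth_spacetime_open_sublevel:
  assumes "smooth_spacetime A a b f" "t \<in> {a..b}"
  shows "open {x. f x t < r}"
proof -
  have "continuous_on UNIV (\<lambda>x. (\<lambda>(x, t). f x t) (x, t))"
    by (rule continuous_on_compose2[OF smooth_spacetime_continuous_on[OF assms(1)]])
      (use assms(2) in \<open>auto intro!: continuous_intros\<close>)
  then show ?thesis by (intro open_Collect_less) (auto intro: continuous_intros)
qed

text \<open>The part of \<open>Z\<close> in the space-time track of the barrier is compact, hence has a point with least time
\<open>t\<close>. The barrier restricted to \<open>[a,t]\<close> is one to which the definition of a weak set flow applies.\<close>

lemma first_contact:
  assumes ab: "0 \<le> a" "a < b" and K: "barrier_via A g a b K f" "compact_family a b K"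
    and Z: "weak_set_flow A g Z" and disj: "K a \<inter> slice Z a = {}"
    and hit: "t1 \<in> {a..b}" "K t1 \<inter> slice Z t1 \<noteq> {}"
  obtains t x where "a < t" "t \<le> b" "(x, t) \<in> Z" "f x t = 0"
    "\<And>c. c \<in> A \<Longrightarrow> x \<in> chart_dom c \<Longrightarrow> Phi g c a b f x t \<ge> 0"
proof -
  let ?S = "{(x, t). t \<in> {a..b} \<and> f x t \<le> 0} \<inter> Z"
  have f: "smooth_spacetime A a b f" and Kf: "\<And>t. t \<in> {a..b} \<Longrightarrow> K t = {x. f x t \<le> 0}"
    using K by (auto simp: barrier_via_def)
  have "compact {(x, t). t \<in> {a..b} \<and> f x t \<le> 0}"
  proof (rule compact_spacetime_sublevel[OF f])
    show "compact (\<Union>t\<in>{a..b}. K t)" using K by (simp add: compact_family_def)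
  qed (use Kf in auto)
  then have "compact ?S"
    using Z by (intro compact_Int_closed) (auto simp: weak_set_flow_def)
  then have "compact (snd ` ?S)"
    by (intro compact_continuous_image continuous_intros)
  moreover have "snd ` ?S \<noteq> {}"
    using hit Kf[OF hit(1)] by (auto simp: slice_def)
  ultimately obtain t where t: "t \<in> snd ` ?S" "\<And>t'. t' \<in> snd ` ?S \<Longrightarrow> t \<le> t'"
    using compact_attains_inf[of "snd ` ?S"] by blast
  then obtain x where x: "t \<in> {a..b}" "f x t \<le> 0" "(x, t) \<in> Z" by force
  have "t \<noteq> a" using disj x Kf by (auto simp: slice_def)
  then have at: "a < t" "{a..t} \<subseteq> {a..b}" using x by auto
  have "K t' \<inter> slice Z t' = {}" if "t' \<in> {a..<t}" for t'
  proof (rule ccontr)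
    assume "K t' \<inter> slice Z t' \<noteq> {}"
    then have "t' \<in> snd ` ?S" using that at Kf[of t'] by (force simp: slice_def image_iff)
    with t(2) that show False by fastforce
  qed
  moreover have "x \<in> K t \<inter> slice Z t" using x Kf by (auto simp: slice_def)
  moreover have contact: "p \<in> frontier (K b) \<and> (\<forall>c\<in>A. p \<in> chart_dom c \<longrightarrow> Phi g c a b f p b \<ge> 0)"
    if "0 \<le> a" "a < b" "barrier_via A g a b K f" "compact_family a b K"
      "\<forall>t\<in>{a..<b}. K t \<inter> slice Z t = {}" "p \<in> K b \<inter> slice Z b" for a b K f p
    using Z that unfolding weak_set_flow_def by blast
  ultimately have c: "x \<in> frontier (K t) \<and> (\<forall>c\<in>A. x \<in> chart_dom c \<longrightarrow> Phi g c a t f x t \<ge> 0)"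
    using ab at barrier_via_subinterval[OF K(1) at(2)] compact_family_subinterval[OF K at(2)]
    by (intro contact) auto
  have "f x t = 0"
  proof (rule ccontr)
    assume "f x t \<noteq> 0"
    then have "x \<in> {x. f x t < 0}" using x by simp
    moreover have "{x. f x t < 0} \<subseteq> K t" unfolding Kf[OF x(1)] by (auto intro: less_imp_le)
    ultimately have "x \<in> interior (K t)"
      using smooth_spacetime_open_sublevel[OF f x(1)] by (meson interiorI)
    with c show False by (simp add: frontier_def)
  qed
  moreover have "Phi g c a b f x t \<ge> 0" if "c \<in> A" "x \<in> chart_dom c" for c
  proof -
    have "Phi g c a t f x t \<ge> 0" using c that by blast
    moreover have "Phi g c a t f x t = Phi g c a b f x t"
      by (rule Phi_subinterval[OF f that _ at]) (use at in simp)
    ultimately show ?thesis by simp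
  qed
  ultimately show ?thesis using that at x by auto
qed

section \<open>Shrinking balls\<close>

lemma flat_ball_has_derivative:
  "((\<lambda>w :: (real ^ 'n) \<times> real. snd w - flat 0 (r - (fst w - y0) \<bullet> (fst w - y0))) has_derivative
    (\<lambda>v. snd v + (flat 2 (r - (fst w - y0) \<bullet> (fst w - y0))) * (2 * ((fst w - y0) \<bullet> fst v)))) (at w)"
proof -
  let ?q = "\<lambda>w :: (real ^ 'n) \<times> real. r - (fst w - y0) \<bullet> (fst w - y0)"
  have q: "(?q has_derivative (\<lambda>v. - 2 * ((fst w - y0) \<bullet> fst v))) (at w)"
    by (auto intro!: derivative_eq_intros simp: inner_commute)
  have "(flat 0 has_derivative (\<lambda>v. flat 2 (?q w) * v)) (at (?q w))"
    using DERIV_flat[of 0 "?q w"] by (simp add: has_field_derivative_def numeral_2_eq_2)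
  from has_derivative_compose[OF q this]
  have "((\<lambda>w. flat 0 (?q w)) has_derivative (\<lambda>v. flat 2 (?q w) * (- 2 * ((fst w - y0) \<bullet> fst v)))) (at w)" .
  from has_derivative_diff[OF has_derivative_snd[OF has_derivative_ident] this]
  show ?thesis by simp
qed

text \<open>The barrier is the ball \<open>\<psi>(x) \<ge> m/2 + M (t - t0)\<close> for a bump function \<open>\<psi>\<close> with maximum \<open>m\<close> at \<open>p\<close>.
While the level stays between \<open>m/2\<close> and \<open>3m/4\<close>, its boundary stays in a compact set without
critical points of \<open>\<psi>\<close>, where the mean curvature times the length of the gradient is bounded. For
\<open>M\<close> above that bound \<^const>\<open>Phi\<close> is negative on the boundary. None of the choices involves the flow or
the starting time.\<close>

lemma shrinking_ball_barrier:
  assumes U: "open U" "p \<in> U"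
  obtains U' T where "open U'" "p \<in> U'" "T > 0"
    "\<And>Z t0 t. weak_set_flow A g Z \<Longrightarrow> 0 \<le> t0 \<Longrightarrow> slice Z t0 \<inter> U = {} \<Longrightarrow> t \<in> {t0..t0 + T} \<Longrightarrow>
      slice Z t \<inter> U' = {}"
proof -
  obtain c where c: "c \<in> A" "p \<in> chart_dom c" by (rule chart_at)
  let ?y0 = "chart_map c p"
  have "open {y \<in> chart_image c. chart_inv c y \<in> U}"
    by (rule open_chart_inv_vimage[OF c(1) U(1)])
  moreover have "?y0 \<in> {y \<in> chart_image c. chart_inv c y \<in> U}"
    using c U by (simp add: chart_map_in chart_inv_map)
  ultimately obtain R where R: "R > 0" "cball ?y0 R \<subseteq> {y \<in> chart_image c. chart_inv c y \<in> U}"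
    by (meson open_contains_cball_eq)
  have ball: "cball ?y0 R \<subseteq> chart_image c" using R by auto
  let ?q = "\<lambda>y. R\<^sup>2 - (y - ?y0) \<bullet> (y - ?y0)"
  let ?\<beta> = "\<lambda>y. flat 0 (?q y)"
  let ?\<psi> = "bump c ?y0 R"
  define m where "m = flat 0 (R\<^sup>2)"
  have m: "m > 0" using R by (simp add: m_def flat_def)
  have bump: "?\<psi> x = ?\<beta> (chart_map c x)" if "x \<in> chart_dom c" for x
    using that by (simp add: bump_def)
  have in_ball: "y \<in> cball ?y0 R" "?q y > 0" if "?\<beta> y > 0" for y
  proof -
    show "?q y > 0" using that by (auto simp: flat_def split: if_splits)
    then have "(dist ?y0 y)\<^sup>2 < R\<^sup>2"
      by (simp add: dist_norm norm_minus_commute[of ?y0] power2_norm_eq_inner)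
    then show "y \<in> cball ?y0 R" using R power2_less_imp_less[of "dist ?y0 y" R] by simp
  qed
  have cont: "continuous_on UNIV ?\<beta>"
    using smooth_on_open_imp_continuous_on[OF smooth_on_open_flat_ball] .
  \<comment> \<open>The punctured ball, on which the bump function has no critical points.\<close>
  define W0 where "W0 = chart_image c \<inter> {y. ?q y > 0} \<inter> - {?y0}"
  define W where "W = W0 \<times> (UNIV :: real set)"
  \<comment> \<open>The second component of the argument is the level that bounds the ball.\<close>
  define H where "H = (\<lambda>w :: (real ^ 'n) \<times> real. snd w - ?\<beta> (fst w))"
  have "open W0"
    unfolding W0_def by (intro open_Int open_chart_image c open_Collect_less open_Compl) (auto intro!: continuous_intros)
  then have oW: "open W" by (simp add: W_def open_Times)
  have "smooth_on_open UNIV (\<lambda>w :: (real ^ 'n) \<times> real. ?\<beta> (fst w))"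
    by (rule smooth_on_open_compose[OF smooth_on_open_bounded_linear smooth_on_open_flat_ball])
      (auto intro: bounded_linear_fst)
  then have "smooth_on_open UNIV H"
    unfolding H_def by (rule smooth_on_open_diff[OF smooth_on_open_bounded_linear[OF open_UNIV bounded_linear_snd]])
  then have H: "smooth_on_open W H" by (rule smooth_on_open_subset[OF _ oW]) auto
  have W: "W \<subseteq> chart_image c \<times> UNIV" by (auto simp: W_def W0_def)
  have nz: "\<exists>v. frechet_derivative H (at w) (v, 0) \<noteq> 0" if "w \<in> W" for w
  proof
    have pos: "?q (fst w) > 0" "fst w \<noteq> ?y0" using that by (auto simp: W_def W0_def)
    have "frechet_derivative H (at w) (fst w - ?y0, 0) =
        flat 2 (?q (fst w)) * (2 * ((fst w - ?y0) \<bullet> (fst w - ?y0)))"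
      using frechet_derivative_at[OF flat_ball_has_derivative[of "R\<^sup>2" ?y0 w], symmetric] by (simp add: H_def)
    moreover have "flat 2 (?q (fst w)) > 0" using pos by (simp add: flat_def)
    ultimately show "frechet_derivative H (at w) (fst w - ?y0, 0) \<noteq> 0" using pos by simp
  qed
  obtain E L where EL: "continuous_on W E" "continuous_on W L" "\<And>w. w \<in> W \<Longrightarrow> L w > 0"
    "\<And>f t y s. (y, s) \<in> W \<Longrightarrow>
      (\<And>y'. (y', s) \<in> W \<Longrightarrow> f (chart_inv c y') t = H (y', s)) \<Longrightarrow>
      mean_curv g c f (chart_inv c y) t = E (y, s) \<and>
      vlength g c (chart_inv c y) (gradient g c (\<lambda>x. f x t) (chart_inv c y)) = L (y, s)"
    by (rule mean_curvature_coordinates[OF c(1) H W nz]) (assumption | blast)+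
  define I where "I = {m / 2..3 * m / 4}"
  define Q where "Q = (cball ?y0 R \<inter> ?\<beta> -` I) \<times> I"
  have "closed (?\<beta> -` I)"
    using cont by (intro continuous_closed_vimage) (auto simp: I_def continuous_on_eq_continuous_at)
  then have "compact Q"
    unfolding Q_def by (intro compact_Times compact_Int_closed) (auto simp: I_def)
  have QW: "(y, s) \<in> W" if "?\<beta> y \<in> I" for y s
  proof -
    have "?\<beta> y > 0" "?\<beta> y < m" using that m by (auto simp: I_def)
    then have "y \<noteq> ?y0" "y \<in> cball ?y0 R" "?q y > 0" using in_ball[of y] by (auto simp: m_def)
    then show ?thesis using ball by (auto simp: W_def W0_def)
  qed
  then have "Q \<subseteq> W" by (auto simp: Q_def)
  then have "continuous_on Q (\<lambda>w. E w * L w)"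
    using EL by (intro continuous_on_mult) (auto intro: continuous_on_subset)
  then have "bounded ((\<lambda>w. E w * L w) ` Q)"
    using \<open>compact Q\<close> by (intro compact_imp_bounded compact_continuous_image)
  then obtain B where B: "\<And>w. w \<in> Q \<Longrightarrow> \<bar>E w * L w\<bar> \<le> B"
    by (auto simp: bounded_iff)
  define M where "M = \<bar>B\<bar> + 1"
  have M: "M > 0" by (simp add: M_def)
  define T where "T = m / (4 * M)"
  have T: "T > 0" "M * T = m / 4" using M m by (simp_all add: T_def)
  let ?U' = "{x \<in> chart_dom c. chart_map c x \<in> {y. ?\<beta> y > 3 * m / 4}}"
  have "open {y. ?\<beta> y > 3 * m / 4}"
    using cont by (intro open_Collect_less) auto
  then have "open ?U'" by (rule open_chart_map_vimage[OF c(1)])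
  moreover have "p \<in> ?U'" using c m by (simp add: m_def[symmetric])
  moreover have "slice Z t \<inter> ?U' = {}"
    if Z: "weak_set_flow A g Z" and t0: "0 \<le> t0" and disj: "slice Z t0 \<inter> U = {}" and t: "t \<in> {t0..t0 + T}"
    for Z t0 t
  proof (rule ccontr)
    assume "slice Z t \<inter> ?U' \<noteq> {}"
    then obtain x1 where x1: "x1 \<in> slice Z t" "x1 \<in> ?U'" by blast
    \<comment> \<open>The level bounding the ball at time t, which has to stay in I until time t0 + T.\<close>
    let ?s = "\<lambda>t. m / 2 + M * (t - t0)"
    let ?F = "\<lambda>x t. ((m / 2 - M * t0) + M * t) + (-1) * ?\<psi> x"
    have F: "?F x t = ?s t - ?\<psi> x" for x t by (simp add: algebra_simps)
    have s: "?s t \<in> I" if "t \<in> {t0..t0 + T}" for t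
    proof -
      have "0 \<le> M * (t - t0)" using that M by simp
      moreover have "M * (t - t0) \<le> M * T" using that M by (intro mult_left_mono) auto
      ultimately show ?thesis using T by (simp add: I_def)
    qed
    let ?K = "\<lambda>t. {x. ?F x t \<le> 0}"
    have sm: "smooth_spacetime A t0 (t0 + T) ?F"
      by (intro smooth_spacetime_add smooth_spacetime_cmult smooth_spacetime_affine smooth_spacetime_space
          smooth_bump[OF c(1) R(1) ball])
    have supp: "x \<in> chart_dom c" "x \<in> chart_inv c ` cball ?y0 R" if "?\<psi> x > 0" for x
      using that bump_support[OF c(1) R(1) ball, of x] by (auto simp: bump_def split: if_splits)
    have KB: "x \<in> chart_inv c ` cball ?y0 R" if "t \<in> {t0..t0 + T}" "?F x t \<le> 0" for x t
    proof (rule supp(2))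
      show "?\<psi> x > 0" using that s[of t] m unfolding F I_def by auto
    qed
    have zero: "x \<in> chart_dom c" "?\<beta> (chart_map c x) = ?s t" if "t \<in> {t0..t0 + T}" "?F x t = 0" for x t
    proof -
      have "?\<psi> x = ?s t" using that(2) unfolding F by simp
      moreover then have "?\<psi> x > 0" using s[OF that(1)] m by (auto simp: I_def)
      then show "x \<in> chart_dom c" by (rule supp)
      ultimately show "?\<beta> (chart_map c x) = ?s t" using bump by simp
    qed
    have inW: "(chart_map c x, ?s t) \<in> W" if "t \<in> {t0..t0 + T}" "?F x t = 0" for x t
      using QW zero(2)[OF that] s[OF that(1)] by simp
    have FH: "?F (chart_inv c y') t = H (y', ?s t)" if "(y', ?s t) \<in> W" for y' t
      using that W bump c by (auto simp: H_def chart_inv_in chart_map_inv algebra_simps)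
    have grad: "gradient g d (\<lambda>q. ?F q t) x \<noteq> 0"
      if t: "t \<in> {t0..t0 + T}" and 0: "?F x t = 0" and d: "d \<in> A" "x \<in> chart_dom d" for t x d
    proof
      assume g0: "gradient g d (\<lambda>q. ?F q t) x = 0"
      obtain D where D: "(((\<lambda>q. ?F q t) \<circ> chart_inv d) has_derivative D) (at (chart_map d x))"
        by (rule smooth_spacetime_has_derivative[OF sm d t])
      from gradient_eq_0_chart_independent[OF d(1) c(1) d(2) zero(1)[OF t 0] D g0]
      have "gradient g c (\<lambda>q. ?F q t) x = 0" .
      then have "vlength g c x (gradient g c (\<lambda>q. ?F q t) x) = 0" by (simp add: vlength_def)
      moreover have "vlength g c (chart_inv c (chart_map c x)) (gradient g c (\<lambda>q. ?F q t) (chart_inv c (chart_map c x)))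
          = L (chart_map c x, ?s t)"
        using EL(4)[OF inW[OF t 0], of ?F t] FH by blast
      ultimately show False
        using EL(3)[OF inW[OF t 0]] chart_inv_map[OF c(1) zero(1)[OF t 0]] by simp
    qed
    have "barrier_via A g t0 (t0 + T) ?K ?F"
      using sm grad by (auto simp: barrier_via_def)
    moreover have "compact_family t0 (t0 + T) ?K"
      by (rule compact_family_sublevel[OF sm bump_compact_support[OF c(1) R(1) ball] KB]) auto
    moreover have "?K t0 \<inter> slice Z t0 = {}"
    proof -
      have "?K t0 \<subseteq> U" using KB[of t0] T R(2) by auto
      then show ?thesis using disj by blast
    qed
    moreover have "?K t \<inter> slice Z t \<noteq> {}"
    proof -
      have "?F x1 t \<le> 0"
        using x1(2) s[OF t] bump[of x1] unfolding F I_def by auto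
      then show ?thesis using x1 by blast
    qed
    ultimately obtain t1 x where t1: "t0 < t1" "t1 \<le> t0 + T" "(x, t1) \<in> Z" "?F x t1 = 0"
      and P: "\<And>c. c \<in> A \<Longrightarrow> x \<in> chart_dom c \<Longrightarrow> Phi g c t0 (t0 + T) ?F x t1 \<ge> 0"
      using first_contact[OF t0, of "t0 + T" ?K ?F Z t] Z t T by auto
    have t1': "t1 \<in> {t0..t0 + T}" using t1 by simp
    let ?w = "(chart_map c x, ?s t1)"
    have w: "?w \<in> W" "?w \<in> Q"
      using inW[OF t1' t1(4)] zero[OF t1' t1(4)] s[OF t1'] in_ball[of "chart_map c x"] m
      by (auto simp: Q_def I_def)
    have "(?F x has_vector_derivative M) (at t1 within {t0..t0 + T})"
      by (auto intro!: derivative_eq_intros simp: has_real_derivative_iff_has_vector_derivative[symmetric])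
    then have "vector_derivative (?F x) (at t1 within {t0..t0 + T}) = M"
      using T t1' by (intro vector_derivative_within_closed_interval) auto
    moreover have "mean_curv g c ?F x t1 = E ?w" "vlength g c x (gradient g c (\<lambda>x. ?F x t1) x) = L ?w"
      using EL(4)[OF w(1), of ?F t1] FH chart_inv_map[OF c(1) zero(1)[OF t1' t1(4)]] by auto
    ultimately have "Phi g c t0 (t0 + T) ?F x t1 = - M / L ?w - E ?w"
      by (simp add: Phi_def normal_velocity_def)
    also have "\<dots> < 0"
    proof -
      have "- (E ?w * L ?w) < M" using B[OF w(2)] by (auto simp: M_def)
      then show ?thesis using EL(3)[OF w(1)] by (simp add: field_simps)
    qed
    finally show False using P[OF c(1) zero(1)[OF t1' t1(4)]] by simp
  qed
  ultimately show ?thesis using that T(1) by blast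
qed

section \<open>Time shifts\<close>

lemma vector_derivative_shift:
  fixes f :: "real \<Rightarrow> real"
  assumes f: "(f has_vector_derivative D) (at (t - s) within {a..b})" and t: "t \<in> {a + s..b + s}" and ab: "a < b"
  shows "vector_derivative (\<lambda>t. f (t - s)) (at t within {a + s..b + s}) = vector_derivative f (at (t - s) within {a..b})"
proof -
  have im: "(\<lambda>t. t - s) ` {a + s..b + s} = {a..b}"
    using image_add_atLeastAtMost[of "- s" "a + s" "b + s"] by (simp add: add.commute image_def)
  have "((\<lambda>t. t - s) has_vector_derivative 1) (at t within {a + s..b + s})"
    by (auto intro!: derivative_eq_intros simp: has_real_derivative_iff_has_vector_derivative[symmetric])
  from vector_diff_chain_within[OF this, of f D] f
  have "((\<lambda>t. f (t - s)) has_vector_derivative D) (at t within {a + s..b + s})"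
    by (simp add: im comp_def)
  then have "vector_derivative (\<lambda>t. f (t - s)) (at t within {a + s..b + s}) = D"
    using t ab by (intro vector_derivative_within_closed_interval) auto
  moreover have "vector_derivative f (at (t - s) within {a..b}) = D"
    using f t ab by (intro vector_derivative_within_closed_interval) auto
  ultimately show ?thesis by simp
qed

text \<open>The flows in a union that approach a contact point at time \<open>b\<close> may do so at times slightly before or
after \<open>b\<close>; shifted barriers reach exactly these times.\<close>

lemma Phi_shift:
  assumes f: "smooth_spacetime A a b f" and c: "c \<in> A" "x \<in> chart_dom c"
    and t: "t \<in> {a + s..b + s}" "a < b"
  shows "Phi g c (a + s) (b + s) (\<lambda>x t. f x (t - s)) x t = Phi g c a b f x (t - s)"
proof -
  have t': "t - s \<in> {a..b}" using t by auto
  obtain W h where W: "(chart_map c x, t - s) \<in> W" "local_rep c a b f W h"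
    by (rule smooth_spacetime_local_rep[OF f c t'])
  have "(f x has_vector_derivative frechet_derivative h (at (chart_map c x, t - s)) (0, 1)) (at (t - s) within {a..b})"
    using local_rep_has_vector_derivative[OF W(2) t' _ W(1)] by (simp add: chart_inv_map[OF c])
  from vector_derivative_shift[OF this t] show ?thesis
    by (simp add: Phi_def normal_velocity_def mean_curv_def unit_normal_def[abs_def])
qed

lemma barrier_via_shift:
  assumes "barrier_via A g a b K f"
  shows "barrier_via A g (a + s) (b + s) (\<lambda>t. K (t - s)) (\<lambda>x t. f x (t - s))"
proof -
  have "t - s \<in> {a..b}" if "t \<in> {a + s..b + s}" for t using that by auto
  then show ?thesis
    using assms smooth_spacetime_shift[of a b f s] unfolding barrier_via_def by blast
qed

lemma compact_family_shift:
  assumes "compact_family a b K"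
  shows "compact_family (a + s) (b + s) (\<lambda>t. K (t - s))"
proof -
  have "(\<Union>t\<in>{a + s..b + s}. K (t - s)) = (\<Union>t\<in>{a..b}. K t)"
  proof (intro equalityI subsetI)
    fix x assume "x \<in> (\<Union>t\<in>{a..b}. K t)"
    then obtain t where "t \<in> {a..b}" "x \<in> K t" by blast
    then show "x \<in> (\<Union>t\<in>{a + s..b + s}. K (t - s))"
      by (intro UN_I[of "t + s"]) auto
  qed auto
  then show ?thesis using assms by (simp add: compact_family_def)
qed

section \<open>Closures of unions of weak set flows\<close>

lemma slice_closure_avoids:
  assumes "open U" "x \<in> U" "open J" "t \<in> J" "\<And>Z s. Z \<in> \<Z> \<Longrightarrow> s \<in> J \<Longrightarrow> slice Z s \<inter> U = {}"
  shows "x \<notin> slice (closure (\<Union>\<Z>)) t"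
proof -
  have "\<Union>\<Z> \<inter> U \<times> J = {}" using assms(5) by (force simp: slice_def)
  then have "closure (\<Union>\<Z>) \<inter> U \<times> J = {}"
    using open_Int_closure_eq_empty[OF open_Times[OF assms(1,3)]] by (metis Int_commute)
  then show ?thesis using assms by (auto simp: slice_def)
qed

text \<open>Shortly before time \<open>b\<close> the barrier contains a fixed neighbourhood of \<open>x\<close>, which then is avoided by
all members of the family. The time for which they keep away from a smaller neighbourhood is the
same for all of them and lasts beyond \<open>b\<close>.\<close>

lemma no_interior_contact:
  assumes fam: "\<And>Z. Z \<in> \<Z> \<Longrightarrow> weak_set_flow A g Z" and ab: "0 \<le> a" "a < b"
    and K: "barrier_via A g a b K f"
    and disj: "\<And>t. t \<in> {a..<b} \<Longrightarrow> K t \<inter> slice (closure (\<Union>\<Z>)) t = {}"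
    and x: "x \<in> slice (closure (\<Union>\<Z>)) b"
  shows "f x b \<ge> 0"
proof (rule ccontr)
  assume "\<not> f x b \<ge> 0"
  then have neg: "f x b < 0" by simp
  have f: "smooth_spacetime A a b f" and Kf: "\<And>t. t \<in> {a..b} \<Longrightarrow> K t = {x. f x t \<le> 0}"
    using K by (auto simp: barrier_via_def)
  obtain N where N: "open N" "N \<inter> UNIV \<times> {a..b} = (\<lambda>(x, t). f x t) -` {..<0} \<inter> UNIV \<times> {a..b}"
    using smooth_spacetime_continuous_on[OF f] open_lessThan[of "0::real"]
    unfolding continuous_on_open_invariant by metis
  have "(x, b) \<in> N \<inter> UNIV \<times> {a..b}"
    unfolding N(2) using neg ab by simp
  then obtain U V where UV: "open U" "open V" "x \<in> U" "b \<in> V" "U \<times> V \<subseteq> N"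
    using open_prod_elim[OF N(1)] by (metis IntD1 mem_Sigma_iff)
  obtain U' T where U': "open U'" "x \<in> U'" "T > 0"
    and avoid: "\<And>Z t0 t. weak_set_flow A g Z \<Longrightarrow> 0 \<le> t0 \<Longrightarrow> slice Z t0 \<inter> U = {} \<Longrightarrow> t \<in> {t0..t0 + T} \<Longrightarrow>
      slice Z t \<inter> U' = {}"
    using shrinking_ball_barrier[OF UV(1,3)] by blast
  obtain e where e: "e > 0" "\<And>t. \<bar>t - b\<bar> < e \<Longrightarrow> t \<in> V"
    using UV(2,4) unfolding open_dist by (metis dist_real_def)
  \<comment> \<open>Late enough for the neighbourhood U to lie inside the barrier and for the time span T
    to lead beyond b.\<close>
  define t0 where "t0 = Max {a, b - e / 2, b - T / 2}"
  have t0: "a \<le> t0" "b - e / 2 \<le> t0" "b - T / 2 \<le> t0" "t0 < b"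
    using ab e(1) U'(3) by (auto simp: t0_def)
  have "U \<subseteq> K t0"
  proof
    fix z assume "z \<in> U"
    moreover have "t0 \<in> V" using e t0 by auto
    ultimately have "(z, t0) \<in> N \<inter> UNIV \<times> {a..b}" using UV(5) t0 by auto
    then have "f z t0 < 0" unfolding N(2) by simp
    then show "z \<in> K t0" using Kf[of t0] t0 by auto
  qed
  then have "U \<inter> slice (closure (\<Union>\<Z>)) t0 = {}" using disj[of t0] t0 by auto
  then have "slice Z t0 \<inter> U = {}" if "Z \<in> \<Z>" for Z
    using that closure_subset[of "\<Union>\<Z>"] by (auto simp: slice_def)
  then have "slice Z s \<inter> U' = {}" if "Z \<in> \<Z>" "s \<in> {t0<..<t0 + T}" for Z s
    using avoid[OF fam[OF that(1)], of t0 s] that ab t0 by auto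
  then have "x \<notin> slice (closure (\<Union>\<Z>)) b"
    by (intro slice_closure_avoids[OF U'(1,2), of "{t0<..<t0 + T}"]) (use t0 U'(3) in auto)
  with x show False by simp
qed

text \<open>At an interior point of \<open>K(t)\<close> the value \<open>0\<close> would be a local maximum of \<open>f(\<cdot>,t)\<close>, where the gradient
vanishes.\<close>

lemma barrier_zero_imp_frontier:
  assumes K: "barrier_via A g a b K f" and t: "t \<in> {a..b}" and x: "f x t = 0"
  shows "x \<in> frontier (K t)"
proof -
  have f: "smooth_spacetime A a b f" and Kf: "K t = {x. f x t \<le> 0}"
    using K t by (auto simp: barrier_via_def)
  have "x \<notin> interior (K t)"
  proof
    assume int: "x \<in> interior (K t)"
    obtain c where c: "c \<in> A" "x \<in> chart_dom c" by (rule chart_at)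
    obtain D where D: "(((\<lambda>q. f q t) \<circ> chart_inv c) has_derivative D) (at (chart_map c x))"
      by (rule smooth_spacetime_has_derivative[OF f c t])
    let ?S = "{y \<in> chart_image c. chart_inv c y \<in> interior (K t)}"
    have "D = (\<lambda>v. 0)"
    proof (rule differential_zero_maxmin)
      show "chart_map c x \<in> ?S" using int c by (simp add: chart_map_in chart_inv_map)
      show "open ?S" by (rule open_chart_inv_vimage[OF c(1)]) simp
      have "((\<lambda>q. f q t) \<circ> chart_inv c) y \<le> ((\<lambda>q. f q t) \<circ> chart_inv c) (chart_map c x)" if "y \<in> ?S" for y
        using that interior_subset[of "K t"] x c Kf by (auto simp: chart_inv_map)
      then show "(\<forall>y\<in>?S. ((\<lambda>q. f q t) \<circ> chart_inv c) y \<le> ((\<lambda>q. f q t) \<circ> chart_inv c) (chart_map c x)) \<or>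
          (\<forall>y\<in>?S. ((\<lambda>q. f q t) \<circ> chart_inv c) (chart_map c x) \<le> ((\<lambda>q. f q t) \<circ> chart_inv c) y)"
        by blast
    qed (rule D)
    then show False
      using gradient_eq_0_iff_critical[OF c D] K t x c by (auto simp: barrier_via_def)
  qed
  moreover have "x \<in> closure (K t)" using x Kf closure_subset[of "K t"] by auto
  ultimately show ?thesis by (simp add: frontier_def)
qed

text \<open>The perturbations are those described at the beginning, with \<open>e\<close>, \<open>d\<close> and \<open>k\<close> in place of \<open>\<epsilon>\<close>, \<open>\<delta>\<close>
and \<open>m + b\<close>. Time and both sizes together are the parameter of the coordinate expression for the mean
curvature.\<close>

lemma Phi_perturbation_continuous:
  assumes f: "smooth_spacetime A a b f" and ab: "a < b" and c: "c \<in> A" and R: "R > 0" "cball y0 R \<subseteq> chart_image c"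
    and nz: "gradient g c (\<lambda>q. f q b) (chart_inv c y0) \<noteq> 0"
  obtains W \<Psi> where "open W" "(y0, (b, 0, 0)) \<in> W" "continuous_on W \<Psi>"
    "\<And>x t e d. x \<in> chart_dom c \<Longrightarrow> t \<in> {a..b} \<Longrightarrow> (chart_map c x, (t, e, d)) \<in> W \<Longrightarrow>
      Phi g c a b (\<lambda>x t. (f x t + e * ((k + (-1) * t) + (-1) * bump c y0 R x)) + d * ((-1) * bump c y0 R x)) x t
        = \<Psi> (chart_map c x, (t, e, d))"
proof -
  let ?\<beta> = "\<lambda>y. flat 0 (R\<^sup>2 - (y - y0) \<bullet> (y - y0))"
  let ?F = "\<lambda>e d x t. (f x t + e * ((k + (-1) * t) + (-1) * bump c y0 R x)) + d * ((-1) * bump c y0 R x)"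
  have y0: "y0 \<in> chart_image c" using R by auto
  obtain W0 h where W0: "(y0, b) \<in> W0" "local_rep c a b f W0 h"
    using smooth_spacetime_local_rep[OF f c chart_inv_in[OF c y0], of b] ab
    by (auto simp: chart_map_inv[OF c y0])
  have h: "smooth_on_open W0 h" and W0sub: "W0 \<subseteq> chart_image c \<times> UNIV"
    using W0 by (auto simp: local_rep_def)
  let ?\<pi> = "\<lambda>w :: (real ^ 'n) \<times> real \<times> real \<times> real. (fst w, fst (snd w))"
  let ?e = "\<lambda>w :: (real ^ 'n) \<times> real \<times> real \<times> real. fst (snd (snd w))"
  let ?d = "\<lambda>w :: (real ^ 'n) \<times> real \<times> real \<times> real. snd (snd (snd w))"
  have bl: "bounded_linear ?\<pi>" "bounded_linear ?e" "bounded_linear ?d"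
    "bounded_linear (\<lambda>w :: (real ^ 'n) \<times> real \<times> real \<times> real. fst (snd w))"
    by (intro bounded_linear_intros)+
  define W1 where "W1 = ?\<pi> -` W0"
  have oW1: "open W1"
    unfolding W1_def by (intro open_vimage smooth_on_open_imp_open[OF h] linear_continuous_on bl)
  define H where "H w = (h (?\<pi> w) + ?e w * ((k + (-1) * fst (snd w)) + (-1) * ?\<beta> (fst w))) + ?d w * ((-1) * ?\<beta> (fst w))" for w
  have hs: "smooth_on_open W1 (\<lambda>w. h (?\<pi> w))"
    by (rule smooth_on_open_compose[OF smooth_on_open_bounded_linear[OF oW1 bl(1)] h]) (auto simp: W1_def)
  have \<beta>s: "smooth_on_open W1 (\<lambda>w. ?\<beta> (fst w))"
    by (rule smooth_on_open_compose[OF smooth_on_open_bounded_linear[OF oW1 bounded_linear_fst] smooth_on_open_flat_ball]) auto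
  have H: "smooth_on_open W1 H"
    unfolding H_def
    by (intro smooth_on_open_add smooth_on_open_mult hs \<beta>s smooth_on_open_const oW1
        smooth_on_open_bounded_linear[OF oW1 bl(2)] smooth_on_open_bounded_linear[OF oW1 bl(3)]
        smooth_on_open_bounded_linear[OF oW1 bl(4)])
  have w0: "(y0, (b, 0, 0)) \<in> W1" using W0 by (simp add: W1_def)
  have FH: "?F e d (chart_inv c y) t = H (y, (t, e, d))" if "(y, (t, e, d)) \<in> W1" "t \<in> {a..b}" for y t e d
  proof -
    have "(y, t) \<in> W0" "y \<in> chart_image c" using that W0sub by (auto simp: W1_def)
    then have "f (chart_inv c y) t = h (y, t)" "bump c y0 R (chart_inv c y) = ?\<beta> y"
      using W0(2) that(2) c by (auto simp: local_rep_def bump_def chart_inv_in chart_map_inv)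
    then show ?thesis by (simp add: H_def)
  qed
  have "\<exists>v. frechet_derivative h (at (y0, b)) (v, 0) \<noteq> 0"
  proof (rule ccontr)
    assume "\<not> ?thesis"
    then have "(\<lambda>v. frechet_derivative h (at (y0, b)) (v, 0)) = (\<lambda>v. 0)" by auto
    then show False
      using gradient_eq_0_iff_critical[OF c chart_inv_in[OF c y0], of "\<lambda>q. f q b"]
        local_rep_has_derivative[OF W0(2) _ W0(1)] nz ab by (simp add: chart_map_inv[OF c y0]) metis
  qed
  then obtain v where v: "frechet_derivative h (at (y0, b)) (v, 0) \<noteq> 0" by blast
  have "((\<lambda>y. H (y, (b, 0, 0))) has_derivative (\<lambda>v. frechet_derivative h (at (y0, b)) (v, 0))) (at y0)"
    using smooth_slice_has_derivative[OF h W0(1)] by (simp add: H_def)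
  from has_derivative_unique[OF this smooth_slice_has_derivative[OF H w0]]
  have v0: "frechet_derivative H (at (y0, (b, 0, 0))) (v, 0) \<noteq> 0" using v by metis
  \<comment> \<open>One direction of non-degeneracy suffices, and it persists in a neighbourhood.\<close>
  define W where "W = W1 \<inter> (\<lambda>w. frechet_derivative H (at w) (v, 0)) -` (- {0})"
  have oW: "open W"
    unfolding W_def
    by (rule continuous_open_preimage[OF smooth_on_open_imp_continuous_on[OF smooth_on_open_frechet_derivative[OF H]] oW1 open_nonzero])
  have WW1: "W \<subseteq> W1" by (auto simp: W_def)
  have w0W: "(y0, (b, 0, 0)) \<in> W" using w0 v0 by (simp add: W_def)
  have HW: "smooth_on_open W H" by (rule smooth_on_open_subset[OF H oW WW1])
  have Wc: "W \<subseteq> chart_image c \<times> UNIV" using WW1 W0sub by (auto simp: W1_def)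
  have nzW: "\<exists>v. frechet_derivative H (at w) (v, 0) \<noteq> 0" if "w \<in> W" for w
    using that by (auto simp: W_def)
  obtain E L where EL: "continuous_on W E" "continuous_on W L" "\<And>w. w \<in> W \<Longrightarrow> L w > 0"
    "\<And>f t y s. (y, s) \<in> W \<Longrightarrow>
      (\<And>y'. (y', s) \<in> W \<Longrightarrow> f (chart_inv c y') t = H (y', s)) \<Longrightarrow>
      mean_curv g c f (chart_inv c y) t = E (y, s) \<and>
      vlength g c (chart_inv c y) (gradient g c (\<lambda>x. f x t) (chart_inv c y)) = L (y, s)"
    by (rule mean_curvature_coordinates[OF c HW Wc nzW]) (assumption | blast)+
  define \<Psi> where "\<Psi> w = - (frechet_derivative h (at (?\<pi> w)) (0, 1) - ?e w) / L w - E w" for w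
  have "continuous_on W (\<lambda>w. frechet_derivative h (at (?\<pi> w)) (0, 1))"
    by (rule continuous_on_compose2[OF smooth_on_open_imp_continuous_on[OF smooth_on_open_frechet_derivative[OF h]]
          linear_continuous_on[OF bl(1)]]) (use WW1 in \<open>auto simp: W1_def\<close>)
  then have "continuous_on W \<Psi>"
    unfolding \<Psi>_def using EL(3)
    by (intro continuous_on_diff continuous_on_divide continuous_on_minus EL linear_continuous_on[OF bl(2)]) force+
  moreover have "Phi g c a b (?F e d) x t = \<Psi> (chart_map c x, (t, e, d))"
    if x: "x \<in> chart_dom c" and t: "t \<in> {a..b}" and w: "(chart_map c x, (t, e, d)) \<in> W" for x t e d
  proof -
    let ?y = "chart_map c x"
    have yt: "(?y, t) \<in> W0" using w WW1 by (auto simp: W1_def)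
    have "(f x has_vector_derivative frechet_derivative h (at (?y, t)) (0, 1)) (at t within {a..b})"
      using local_rep_has_vector_derivative[OF W0(2) t _ yt] by (simp add: chart_inv_map[OF c x])
    then have "(?F e d x has_vector_derivative frechet_derivative h (at (?y, t)) (0, 1) - e) (at t within {a..b})"
      by (auto intro!: derivative_eq_intros simp: has_real_derivative_iff_has_vector_derivative[symmetric])
    then have "vector_derivative (?F e d x) (at t within {a..b}) = frechet_derivative h (at (?y, t)) (0, 1) - e"
      using ab t by (intro vector_derivative_within_closed_interval)
    moreover have "?F e d (chart_inv c y') t = H (y', (t, e, d))" if "(y', (t, e, d)) \<in> W" for y'
      using FH[OF _ t] that WW1 by blast
    from EL(4)[OF w, of "?F e d" t, OF this]
    have "mean_curv g c (?F e d) x t = E (?y, (t, e, d))"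
        "vlength g c x (gradient g c (\<lambda>x. ?F e d x t) x) = L (?y, (t, e, d))"
      unfolding chart_inv_map[OF c x] by blast+
    ultimately show ?thesis by (simp add: Phi_def normal_velocity_def \<Psi>_def)
  qed
  ultimately show ?thesis using that oW w0W by blast
qed

text \<open>The term with \<open>e\<close> makes \<open>(p,b)\<close> the only point of contact with the closure, and the term with \<open>d\<close>
enlarges the barrier so that it is reached by members of the family. Their points of first contact
converge to \<open>(p,b)\<close> as \<open>d\<close> tends to \<open>0\<close>.\<close>

lemma boundary_contact:
  assumes fam: "\<And>Z. Z \<in> \<Z> \<Longrightarrow> weak_set_flow A g Z" and ab: "0 \<le> a" "a < b"
    and K: "barrier_via A g a b K f" "compact_family a b K"
    and disj: "\<And>t. t \<in> {a..<b} \<Longrightarrow> K t \<inter> slice (closure (\<Union>\<Z>)) t = {}"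
    and p: "p \<in> slice (closure (\<Union>\<Z>)) b" "f p b = 0"
    and c: "c \<in> A" "p \<in> chart_dom c"
  shows "Phi g c a b f p b \<ge> 0"
proof (rule ccontr)
  assume "\<not> Phi g c a b f p b \<ge> 0"
  then have neg: "Phi g c a b f p b < 0" by simp
  let ?Y = "closure (\<Union>\<Z>)"
  \<comment> \<open>A positive starting time leaves room for shifts in both directions.\<close>
  define a' where "a' = (a + b) / 2"
  have a': "0 < a'" "a \<le> a'" "a' < b" "{a'..b} \<subseteq> {a..b}" using ab by (auto simp: a'_def)
  have f: "smooth_spacetime A a b f" and Kf: "\<And>t. t \<in> {a..b} \<Longrightarrow> K t = {x. f x t \<le> 0}"
    using K by (auto simp: barrier_via_def)
  have f': "smooth_spacetime A a' b f" by (rule smooth_spacetime_subinterval[OF f a'(4)])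
  note K' = barrier_via_subinterval[OF K(1) a'(4)] compact_family_subinterval[OF K a'(4)]
  let ?y0 = "chart_map c p"
  obtain R where R: "R > 0" "cball ?y0 R \<subseteq> chart_image c"
    using open_chart_image[OF c(1)] chart_map_in[OF c] by (meson open_contains_cball_eq)
  have invy0: "chart_inv c ?y0 = p" by (rule chart_inv_map[OF c])
  define m where "m = flat 0 (R\<^sup>2)"
  let ?\<psi> = "bump c ?y0 R"
  note bump = bump_nonneg[OF c(1) R] bump_le[OF c(1) R, folded m_def] bump_lt[OF c(1) R, folded m_def, unfolded invy0]
    bump_center[OF c(1) R, folded m_def, unfolded invy0] bump_support[OF c(1) R]
  have m: "m > 0" using R by (simp add: m_def flat_def)
  let ?w1 = "\<lambda>x t. ((m + b) + (-1) * t) + (-1) * ?\<psi> x"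
  let ?w2 = "\<lambda>x (t::real). (-1) * ?\<psi> x"
  let ?F = "\<lambda>e d x t. (f x t + e * ?w1 x t) + d * ?w2 x t"
  have w1_nonneg: "?w1 x t \<ge> 0" if "t \<in> {a'..b}" for x t
    using that bump(2)[of x] by auto
  have \<psi>s: "smooth_spacetime A a' b (\<lambda>x t. ?\<psi> x)"
    by (rule smooth_spacetime_space[OF smooth_bump[OF c(1) R]])
  have w: "smooth_spacetime A a' b ?w1" "smooth_spacetime A a' b ?w2"
    by (rule smooth_spacetime_add[OF smooth_spacetime_affine smooth_spacetime_cmult[OF \<psi>s]],
        rule smooth_spacetime_cmult[OF \<psi>s])
  have F: "smooth_spacetime A a' b (?F e d)" for e d
    by (rule smooth_spacetime_add[OF smooth_spacetime_add[OF f' smooth_spacetime_cmult[OF w(1)]]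
            smooth_spacetime_cmult[OF w(2)]])
  have "gradient g c (\<lambda>q. f q b) (chart_inv c ?y0) \<noteq> 0"
    using K p(2) c ab unfolding invy0 by (auto simp: barrier_via_def)
  then obtain W \<Psi> where W: "open W" "(?y0, (b, 0, 0)) \<in> W" "continuous_on W \<Psi>"
    and \<Psi>: "\<And>x t e d. x \<in> chart_dom c \<Longrightarrow> t \<in> {a'..b} \<Longrightarrow> (chart_map c x, (t, e, d)) \<in> W \<Longrightarrow>
      Phi g c a' b (?F e d) x t = \<Psi> (chart_map c x, (t, e, d))"
    by (rule Phi_perturbation_continuous[OF f' a'(3) c(1) R, where k = "m + b"]) blast
  define N where "N = W \<inter> \<Psi> -` {..<0}"
  have oN: "open N" unfolding N_def by (rule continuous_open_preimage[OF W(3,1)]) simp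
  have "Phi g c a' b f p b = Phi g c a b f p b"
    by (rule Phi_subinterval[OF f c _ a'(3,4)]) (use a' in auto)
  then have "\<Psi> (?y0, (b, 0, 0)) < 0"
    using \<Psi>[OF c(2) _ W(2)] neg a'(3) by simp
  then have N0: "(?y0, (b, 0, 0)) \<in> N" using W(2) by (simp add: N_def)
  have "((\<lambda>e. (?y0, (b, e, 0::real))) \<longlongrightarrow> (?y0, (b, 0, 0))) (at_right 0)"
    by (intro tendsto_intros)
  from topological_tendstoD[OF this oN N0]
  have ev1: "eventually (\<lambda>e. (?y0, (b, e, 0)) \<in> N) (at_right 0)" .
  have ev2: "eventually (\<lambda>e. barrier_via A g a' b (\<lambda>t. {x. f x t + e * ?w1 x t \<le> 0}) (\<lambda>x t. f x t + e * ?w1 x t) \<and>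
      compact_family a' b (\<lambda>t. {x. f x t + e * ?w1 x t \<le> 0})) (at_right 0)"
    by (rule barrier_perturbation[OF K' w(1) compact_empty w1_nonneg])
  have ev3: "eventually (\<lambda>e. e > 0) (at_right (0::real))" by (simp add: eventually_at_right_less)
  obtain e where e: "e > 0" "(?y0, (b, e, 0)) \<in> N"
    and Ke: "barrier_via A g a' b (\<lambda>t. {x. f x t + e * ?w1 x t \<le> 0}) (\<lambda>x t. f x t + e * ?w1 x t)"
      "compact_family a' b (\<lambda>t. {x. f x t + e * ?w1 x t \<le> 0})"
    using eventually_happens'[OF trivial_limit_at_right_real eventually_conj[OF ev3 eventually_conj[OF ev1 ev2]]]
    by blast
  let ?B = "chart_inv c ` cball ?y0 R"
  have cB: "compact ?B" by (rule bump_compact_support[OF c(1) R])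
  have "eventually (\<lambda>d. barrier_via A g a' b (\<lambda>t. {x. ?F e d x t \<le> 0}) (?F e d) \<and>
      compact_family a' b (\<lambda>t. {x. ?F e d x t \<le> 0})) (at_right 0)"
    by (rule barrier_perturbation[OF Ke w(2) cB]) (simp add: bump(5))
  then obtain d0 where d0: "d0 > 0"
    and Kd: "\<And>d. 0 < d \<Longrightarrow> d < d0 \<Longrightarrow> barrier_via A g a' b (\<lambda>t. {x. ?F e d x t \<le> 0}) (?F e d)"
      "\<And>d. 0 < d \<Longrightarrow> d < d0 \<Longrightarrow> compact_family a' b (\<lambda>t. {x. ?F e d x t \<le> 0})"
    unfolding eventually_at_right_field by blast
  \<comment> \<open>Either the perturbed barrier meets the closure at its starting time, or it has a first contact
    with a member of the family. The first case is excluded for small d as well by passing to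
    the limit, so both are treated together; s is the shift in time.\<close>
  define good where "good d q \<longleftrightarrow> (case q of (z, t, s) \<Rightarrow> t \<in> {a'..b} \<and> \<bar>s\<bar> < d \<and> (z, t + s) \<in> ?Y \<and> ?F e d z t \<le> 0 \<and>
      (t = a' \<or> (z \<in> chart_dom c \<longrightarrow> Phi g c a' b (?F e d) z t \<ge> 0)))" for d q
  have ex: "\<exists>q. good d q" if d: "0 < d" "d < d0" "d \<le> a'" for d
  proof -
    let ?G = "?F e d"
    \<comment> \<open>A neighbourhood of (p, b), because the term with d is negative at p while the others vanish.\<close>
    let ?O = "{x. ?G x b < 0} \<times> ball b d"
    have "open ?O"
      by (rule open_Times[OF smooth_spacetime_open_sublevel[OF F] open_ball]) (use a' in simp)
    moreover have "(p, b) \<in> ?O \<inter> ?Y"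
      using p d m by (simp add: bump(4) slice_def)
    ultimately have "?O \<inter> \<Union>\<Z> \<noteq> {}"
      using open_Int_closure_eq_empty by blast
    then obtain x t Z where xt: "(x, t) \<in> Z" "Z \<in> \<Z>" "?G x b < 0" "\<bar>t - b\<bar> < d"
      by (auto simp: dist_real_def abs_minus_commute)
    have ZY: "(z, t) \<in> ?Y" if "(z, t) \<in> Z" for z t
      using that xt(2) closure_subset[of "\<Union>\<Z>"] by blast
    define s where "s = t - b"
    let ?Gs = "\<lambda>x t. ?G x (t - s)" and ?Ks = "\<lambda>t. {x. ?G x (t - s) \<le> 0}"
    have s: "\<bar>s\<bar> < d" "0 \<le> a' + s" "a' + s < b + s" "b + s \<in> {a' + s..b + s}"
      using xt(4) d a' by (auto simp: s_def)
    have Kd': "barrier_via A g (a' + s) (b + s) ?Ks ?Gs" "compact_family (a' + s) (b + s) ?Ks"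
      using barrier_via_shift[OF Kd(1)[OF d(1,2)], of s] compact_family_shift[OF Kd(2)[OF d(1,2)], of s] by simp_all
    show ?thesis
    proof (cases "?Ks (a' + s) \<inter> slice Z (a' + s) = {}")
      case False
      then obtain z where "?G z a' \<le> 0" "(z, a' + s) \<in> Z" by (auto simp: slice_def)
      then have "good d (z, a', s)" using s a' ZY by (auto simp: good_def)
      then show ?thesis by blast
    next
      case True
      have "x \<in> ?Ks (b + s) \<inter> slice Z (b + s)" using xt by (simp add: s_def slice_def)
      then have "?Ks (b + s) \<inter> slice Z (b + s) \<noteq> {}" by blast
      from first_contact[OF s(2,3) Kd' fam[OF xt(2)] True s(4) this]
      obtain t1 z where t1: "a' + s < t1" "t1 \<le> b + s" "(z, t1) \<in> Z" "?Gs z t1 = 0"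
        and P: "\<And>c. c \<in> A \<Longrightarrow> z \<in> chart_dom c \<Longrightarrow> Phi g c (a' + s) (b + s) ?Gs z t1 \<ge> 0"
        by blast
      have "Phi g c a' b ?G z (t1 - s) \<ge> 0" if "z \<in> chart_dom c"
        using P[OF c(1) that] Phi_shift[OF F[of e d] c(1) that _ a'(3), of t1 s] t1 by simp
      moreover have "?G z (t1 - s) \<le> 0" using t1(4) by (rule eq_refl)
      moreover have "t1 - s \<in> {a'..b}" using t1 by simp
      moreover have "(z, (t1 - s) + s) \<in> ?Y" using ZY[OF t1(3)] by simp
      ultimately have "good d (z, t1 - s, s)"
        using s(1) unfolding good_def prod.case by blast
      then show ?thesis by blast
    qed
  qed
  define \<delta> where "\<delta> n = min (d0 / 2) a' * inverse (real (Suc n))" for n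
  have \<delta>: "0 < \<delta> n" "\<delta> n < d0" "\<delta> n \<le> a'" for n
  proof -
    have i: "0 < inverse (real (Suc n))" "inverse (real (Suc n)) \<le> 1" by (auto simp: field_simps)
    have mn: "0 < min (d0 / 2) a'" using d0 a' by simp
    then show "0 < \<delta> n" using i by (simp add: \<delta>_def)
    have "\<delta> n \<le> min (d0 / 2) a'" unfolding \<delta>_def using i mn by (intro mult_left_le) auto
    then show "\<delta> n < d0" "\<delta> n \<le> a'" using d0 by auto
  qed
  have \<delta>0: "\<delta> \<longlonglongrightarrow> 0"
    unfolding \<delta>_def using tendsto_mult_right_zero[OF LIMSEQ_inverse_real_of_nat] by simp
  have "\<forall>n. \<exists>q. good (\<delta> n) q" using ex \<delta> by blast
  from choice[OF this] obtain q where q: "\<And>n. good (\<delta> n) (q n)" by blast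
  define z where "z n = fst (q n)" for n
  define \<tau> where "\<tau> n = fst (snd (q n))" for n
  define s where "s n = snd (snd (q n))" for n
  have g: "\<tau> n \<in> {a'..b}" "\<bar>s n\<bar> < \<delta> n" "(z n, \<tau> n + s n) \<in> ?Y" "?F e (\<delta> n) (z n) (\<tau> n) \<le> 0"
    "\<tau> n = a' \<or> (z n \<in> chart_dom c \<longrightarrow> Phi g c a' b (?F e (\<delta> n)) (z n) (\<tau> n) \<ge> 0)" for n
    using q[of n] unfolding good_def z_def \<tau>_def s_def by (auto simp: case_prod_beta)
  let ?L = "(\<Union>t\<in>{a'..b}. K t) \<union> ?B"
  have cL: "compact ?L" using cB K'(2) by (auto simp: compact_family_def)
  have zL: "z n \<in> ?L" for n
  proof (rule ccontr)
    assume zn: "z n \<notin> ?L"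
    then have "f (z n) (\<tau> n) > 0" using g(1)[of n] Kf a'(4) by force
    moreover have "e * ?w1 (z n) (\<tau> n) \<ge> 0" using w1_nonneg[OF g(1)] e(1) by simp
    moreover have "\<delta> n * ?w2 (z n) (\<tau> n) = 0" using zn bump(5) by simp
    ultimately show False using g(4)[of n] by linarith
  qed
  obtain r z0 \<tau>0 where r: "strict_mono (r :: nat \<Rightarrow> nat)" "z0 \<in> ?L" "\<tau>0 \<in> {a'..b}"
    and lim: "(\<lambda>n. z (r n)) \<longlonglongrightarrow> z0" "(\<lambda>n. \<tau> (r n)) \<longlonglongrightarrow> \<tau>0"
    by (rule spacetime_seq_limit[OF cL zL g(1)])
  have \<delta>r: "(\<lambda>n. \<delta> (r n)) \<longlonglongrightarrow> 0"
    using LIMSEQ_subseq_LIMSEQ[OF \<delta>0 r(1)] by (simp add: comp_def)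
  have sr: "(\<lambda>n. s (r n)) \<longlonglongrightarrow> 0"
  proof (rule tendsto_0_le[OF \<delta>r, where K = 1])
    show "eventually (\<lambda>n. norm (s (r n)) \<le> norm (\<delta> (r n)) * 1) sequentially"
    proof (rule always_eventually, rule allI)
      show "norm (s (r n)) \<le> norm (\<delta> (r n)) * 1" for n
        using g(2)[of "r n"] \<delta>(1)[of "r n"] by simp
    qed
  qed
  have "(\<lambda>n. (z (r n), \<tau> (r n) + s (r n))) \<longlonglongrightarrow> (z0, \<tau>0 + 0)"
    by (intro tendsto_Pair tendsto_add lim sr)
  then have zY: "(z0, \<tau>0) \<in> ?Y"
    using closed_sequentially[OF closed_closure, of "\<lambda>n. (z (r n), \<tau> (r n) + s (r n))" "\<Union>\<Z>"] g(3) by simp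
  have "(\<lambda>n. ?F e (\<delta> (r n)) (z (r n)) (\<tau> (r n))) \<longlonglongrightarrow> (f z0 \<tau>0 + e * ?w1 z0 \<tau>0) + 0 * ?w2 z0 \<tau>0"
    by (rule tendsto_add[OF tendsto_add[OF spacetime_tendsto[OF f' lim g(1) r(3)]
            tendsto_mult[OF tendsto_const spacetime_tendsto[OF w(1) lim g(1) r(3)]]]
          tendsto_mult[OF \<delta>r spacetime_tendsto[OF w(2) lim g(1) r(3)]]])
  from LIMSEQ_le_const2[OF this] g(4) have le: "f z0 \<tau>0 + e * ?w1 z0 \<tau>0 \<le> 0" by simp
  have "e * ?w1 z0 \<tau>0 \<ge> 0" using w1_nonneg[OF r(3)] e(1) by simp
  with le have f0: "f z0 \<tau>0 \<le> 0" by linarith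
  have \<tau>0: "\<tau>0 = b"
  proof (rule ccontr)
    assume "\<tau>0 \<noteq> b"
    then have "\<tau>0 \<in> {a..<b}" using r(3) a'(2) by auto
    then have "z0 \<in> K \<tau>0 \<inter> slice ?Y \<tau>0" using Kf[of \<tau>0] f0 zY by (auto simp: slice_def)
    with disj[OF \<open>\<tau>0 \<in> {a..<b}\<close>] show False by blast
  qed
  \<comment> \<open>At time b the term with e is positive away from p, so any other limit point would be an interior
    point of K(b).\<close>
  have z0: "z0 = p"
  proof (rule ccontr)
    assume "z0 \<noteq> p"
    then have "e * ?w1 z0 \<tau>0 > 0" using bump(3)[of z0] e(1) \<tau>0 by simp
    with le have "f z0 \<tau>0 < 0" by linarith
    then have "f z0 b < 0" using \<tau>0 by simp
    moreover have "f z0 b \<ge> 0"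
      using no_interior_contact[OF fam ab K(1) disj, of z0] zY \<tau>0 by (simp add: slice_def)
    ultimately show False by simp
  qed
  let ?v = "\<lambda>n. (chart_map c (z (r n)), (\<tau> (r n), e, \<delta> (r n)))"
  have zc: "(\<lambda>n. z (r n)) \<longlonglongrightarrow> p" using lim(1) z0 by simp
  have "?v \<longlonglongrightarrow> (?y0, (b, e, 0))"
    using lim(2) \<tau>0 by (intro tendsto_Pair tendsto_const \<delta>r chart_seq(2)[OF c zc]) simp
  from topological_tendstoD[OF this oN e(2)]
  have e1: "eventually (\<lambda>n. ?v n \<in> N) sequentially" .
  have e2: "eventually (\<lambda>n. z (r n) \<in> chart_dom c) sequentially" by (rule chart_seq(1)[OF c zc])
  have e3: "eventually (\<lambda>n. \<tau> (r n) > a') sequentially"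
    using order_tendstoD(1)[OF lim(2), of a'] \<tau>0 a'(3) by simp
  obtain n where n: "?v n \<in> N" "z (r n) \<in> chart_dom c" "\<tau> (r n) > a'"
    using eventually_happens'[OF sequentially_bot eventually_conj[OF e1 eventually_conj[OF e2 e3]]] by blast
  have "Phi g c a' b (?F e (\<delta> (r n))) (z (r n)) (\<tau> (r n)) = \<Psi> (?v n)"
    using n(1) by (intro \<Psi> n(2) g(1)) (simp add: N_def)
  also have "\<dots> < 0" using n(1) by (simp add: N_def)
  finally show False using g(5)[of "r n"] n by auto
qed

lemma weak_set_flow_closure_Union:
  assumes fam: "\<And>Z. Z \<in> \<Z> \<Longrightarrow> weak_set_flow A g Z"
  shows "weak_set_flow A g (closure (\<Union>\<Z>))"
  unfolding weak_set_flow_def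
proof (intro conjI allI impI)
  have "\<Union>\<Z> \<subseteq> UNIV \<times> {0..}" using fam unfolding weak_set_flow_def by blast
  then show "closure (\<Union>\<Z>) \<subseteq> UNIV \<times> {0..}"
    by (rule closure_minimal) (auto intro: closed_Times)
  fix a b K f p
  assume *: "0 \<le> a \<and> a < b \<and> barrier_via A g a b K f \<and> compact_family a b K \<and>
    (\<forall>t\<in>{a..<b}. K t \<inter> slice (closure (\<Union>\<Z>)) t = {}) \<and> p \<in> K b \<inter> slice (closure (\<Union>\<Z>)) b"
  then have ab: "0 \<le> a" "a < b" and K: "barrier_via A g a b K f" "compact_family a b K"
    and disj: "\<And>t. t \<in> {a..<b} \<Longrightarrow> K t \<inter> slice (closure (\<Union>\<Z>)) t = {}"
    and p: "p \<in> K b" "p \<in> slice (closure (\<Union>\<Z>)) b" by auto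
  have "f p b \<ge> 0" by (rule no_interior_contact[OF fam ab K(1) disj p(2)])
  moreover have "f p b \<le> 0" using K(1) p(1) ab by (auto simp: barrier_via_def)
  ultimately have 0: "f p b = 0" by simp
  then show "p \<in> frontier (K b)" using ab by (intro barrier_zero_imp_frontier[OF K(1)]) auto
  show "\<forall>c\<in>A. p \<in> chart_dom c \<longrightarrow> 0 \<le> Phi g c a b f p b"
    using boundary_contact[OF fam ab K disj p(2) 0] by blast
qed simp

text \<open>The barrier condition is vacuous: barriers end at a positive time, when nothing is left.\<close>

lemma weak_set_flow_initial_slice:
  assumes "closed C"
  shows "weak_set_flow A g (C \<times> {0})"
  using closed_Times[OF assms closed_singleton[of 0]] by (auto simp: weak_set_flow_def slice_def)

lemma biggest_flow_exists:
  assumes "closed C"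
  shows "\<exists>Y. weak_set_flow A g Y \<and> slice Y 0 = C \<and>
    (\<forall>Z. weak_set_flow A g Z \<and> slice Z 0 \<subseteq> C \<longrightarrow> (\<forall>t\<ge>0. slice Z t \<subseteq> slice Y t))"
proof -
  define \<Z> where "\<Z> = {Z. weak_set_flow A g Z \<and> slice Z 0 \<subseteq> C}"
  let ?Y = "closure (\<Union>\<Z>)"
  have C: "C \<times> {0} \<in> \<Z>"
    using weak_set_flow_initial_slice[OF assms] by (auto simp: \<Z>_def slice_def)
  have "weak_set_flow A g ?Y"
    by (rule weak_set_flow_closure_Union) (simp add: \<Z>_def)
  moreover have "slice ?Y 0 = C"
  proof
    show "C \<subseteq> slice ?Y 0"
      using C closure_subset[of "\<Union>\<Z>"] by (auto simp: slice_def)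
    show "slice ?Y 0 \<subseteq> C"
    proof
      fix x assume x: "x \<in> slice ?Y 0"
      show "x \<in> C"
      proof (rule ccontr)
        assume "x \<notin> C"
        then obtain U T where U: "open U" "x \<in> U" "T > 0"
          and avoid: "\<And>Z t0 t. weak_set_flow A g Z \<Longrightarrow> 0 \<le> t0 \<Longrightarrow> slice Z t0 \<inter> - C = {} \<Longrightarrow> t \<in> {t0..t0 + T} \<Longrightarrow>
            slice Z t \<inter> U = {}"
          using shrinking_ball_barrier[of "- C" x] assms by (auto simp: open_Compl)
        have "slice Z t \<inter> U = {}" if "Z \<in> \<Z>" "t \<in> {..<T}" for Z t
        proof (cases "t < 0")
          case True
          then show ?thesis using that by (auto simp: \<Z>_def weak_set_flow_def slice_def)
        next
          case False
          then show ?thesis using avoid[of Z 0 t] that by (auto simp: \<Z>_def)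
        qed
        then have "x \<notin> slice ?Y 0"
          by (intro slice_closure_avoids[OF U(1,2), of "{..<T}"]) (use U(3) in auto)
        with x show False by simp
      qed
    qed
  qed
  moreover have "slice Z t \<subseteq> slice ?Y t" if "weak_set_flow A g Z" "slice Z 0 \<subseteq> C" for Z t
    using that closure_subset[of "\<Union>\<Z>"] by (auto simp: \<Z>_def slice_def)
  ultimately show ?thesis by blast
qed

end

theorem theorem19:
  fixes A :: "('a::{t2_space, second_countable_topology}, 'n::finite) chart set"
    and g :: "('a, 'n) metric_tensor"
    and C :: "'a set"
  assumes "riemannian_manifold A g" and "closed C"
  shows "\<exists>Y. weak_set_flow A g Y \<and>
             slice Y 0 = C \<and>
             (\<forall>Z. weak_set_flow A g Z \<and> slice Z 0 \<subseteq> C \<longrightarrow> (\<forall>t\<ge>0. slice Z t \<subseteq> slice Y t))"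
  using riemannian_manifold.biggest_flow_exists[OF assms] .

end
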